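(* Let $F$ be a commutative field, $0\le h\le n-2$, and let $\chi:\Gamma(n,h+1,F)\to\mathrm{PG}(n,F)$ be a linear mapping with non-empty domain such that $V^\chi\in V$ (the point $V^\chi$ lies in $V$) for each $V\in\mathbb D(\chi)$. Then there is a unique linear complex $K$ of $h$-subspaces of $\mathrm{PG}(n,F)$ such that $\chi=\downarrow K$.
   Context: A $d$-subspace is a projective subspace of dimension $d$. Grassmannian $\Gamma(n,k,F)$: points are $k$-subspaces, lines are pencils $\{X:U\subset X\subset W,\dim X=k\}$ with $\dim U=k-1$, $\dim W=k+1$. A partial map $\chi$ has domain $\mathbb D(\chi)$, exceptional set $\mathbb A(\chi)$ (complement), $\phi^\chi=\{X^\chi:X\in\phi\cap\mathbb D(\chi)\}$; it is a linear mapping if for each line $\ell$ exactly one holds: (i) $\ell^\chi$ is a line and $\chi$ maps $\ell$ bijectively onto it; (ii) $\ell^\chi$ is one point and $|\ell\cap\mathbb A(\chi)|=1$; (iii) $\ell\subseteq\mathbb A(\chi)$. A linear complex of $h$-subspaces is the set of $h$-subspaces whose Plücker image ($F(v_0\wedge\cdots\wedge v_h)$ for a basis $v_0,\dots,v_h$) lies in a fixed hyperplane of $\mathbb P(\bigwedge^{h+1}F^{n+1})$. For such $K$, an $(h+1)$-subspace $V$ is total if all $h$-subspaces contained in $V$ lie in $K$; otherwise there is a unique point $P$ (the pole of $V$) such that an $h$-subspace $X\subseteq V$ belongs to $K$ iff $P\in X$. The dual polarity $\downarrow K$ is the partial map on $(h+1)$-subspaces with exceptional set the total $(h+1)$-subspaces,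 sending each non-total $V$ to its pole. *)

theory Defs
  imports "HOL-Analysis.Analysis"
begin

text \<open>The ambient vector space is F^(n+1), modelled as 'a ^ 'n with CARD('n) = n + 1.
  A projective d-subspace of PG(n,F) is a vector subspace of (vector) dimension d + 1.\<close>

definition psub :: "nat \<Rightarrow> ('a::field ^ 'n) set \<Rightarrow> bool" where
  "psub d X \<longleftrightarrow> vec.subspace X \<and> vec.dim X = d + 1"

text \<open>Vector subspaces of vector dimension k (projective dimension k - 1; k = 0 gives the
  empty projective subspace).\<close>
definition vsub :: "nat \<Rightarrow> ('a::field ^ 'n) set \<Rightarrow> bool" where
  "vsub k X \<longleftrightarrow> vec.subspace X \<and> vec.dim X = k"

definition grass_line :: "nat \<Rightarrow> ('a::field ^ 'n) set set \<Rightarrow> bool" where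
  "grass_line k L \<longleftrightarrow> (\<exists>U W. vsub k U \<and> vsub (k + 2) W \<and> U \<subseteq> W \<and>
      L = {X. psub k X \<and> U \<subseteq> X \<and> X \<subseteq> W})"

definition pdom :: "nat \<Rightarrow> (('a::field ^ 'n) set \<Rightarrow> ('a ^ 'n) set option) \<Rightarrow> ('a ^ 'n) set set" where
  "pdom k chi = {X. psub k X \<and> chi X \<noteq> None}"

definition pexc :: "nat \<Rightarrow> (('a::field ^ 'n) set \<Rightarrow> ('a ^ 'n) set option) \<Rightarrow> ('a ^ 'n) set set" where
  "pexc k chi = {X. psub k X \<and> chi X = None}"

definition pimage :: "(('a::field ^ 'n) set \<Rightarrow> ('a ^ 'n) set option) \<Rightarrow> ('a ^ 'n) set set \<Rightarrow> ('a ^ 'n) set set" where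
  "pimage chi \<phi> = {the (chi X) | X. X \<in> \<phi> \<and> chi X \<noteq> None}"

definition linear_mapping_pts :: "nat \<Rightarrow> (('a::field ^ 'n) set \<Rightarrow> ('a ^ 'n) set option) \<Rightarrow> bool" where
  "linear_mapping_pts k chi \<longleftrightarrow>
     (\<forall>X \<in> pdom k chi. psub 0 (the (chi X))) \<and>
     (\<forall>L. grass_line k L \<longrightarrow>
        (let c1 = (grass_line 0 (pimage chi L) \<and> L \<subseteq> pdom k chi \<and>
                   bij_betw (\<lambda>X. the (chi X)) L (pimage chi L));
             c2 = (card (pimage chi L) = 1 \<and> card (L \<inter> pexc k chi) = 1);
             c3 = (L \<subseteq> pexc k chi)
         in (c1 \<and> \<not> c2 \<and> \<not> c3) \<or> (\<not> c1 \<and> c2 \<and> \<not> c3) \<or> (\<not> c1 \<and> \<not> c2 \<and> c3)))"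

definition alt_form :: "nat \<Rightarrow> ((nat \<Rightarrow> 'a::field ^ 'n) \<Rightarrow> 'a) \<Rightarrow> bool" where
  "alt_form m f \<longleftrightarrow>
     (\<forall>v w. (\<forall>i<m. v i = w i) \<longrightarrow> f v = f w) \<and>
     (\<forall>i<m. \<forall>v x y a b. f (v(i := a *s x + b *s y)) = a * f (v(i := x)) + b * f (v(i := y))) \<and>
     (\<forall>v i j. i < m \<longrightarrow> j < m \<longrightarrow> i \<noteq> j \<longrightarrow> v i = v j \<longrightarrow> f v = 0)"

text \<open>Linear complex of h-subspaces: the Pluecker image v_0 \<and> ... \<and> v_h of some basis
  lies in the hyperplane given by a nonzero functional f on the (h+1)-th exterior power.\<close>
definition linear_complex :: "nat \<Rightarrow> ('a::field ^ 'n) set set \<Rightarrow> bool" where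
  "linear_complex h K \<longleftrightarrow> (\<exists>f. alt_form (Suc h) f \<and> (\<exists>v. f v \<noteq> 0) \<and>
     K = {X. psub h X \<and> (\<exists>v. inj_on v {..h} \<and> vec.independent (v ` {..h}) \<and>
                              vec.span (v ` {..h}) = X \<and> f v = 0)})"

definition total :: "nat \<Rightarrow> ('a::field ^ 'n) set set \<Rightarrow> ('a ^ 'n) set \<Rightarrow> bool" where
  "total h K V \<longleftrightarrow> (\<forall>X. psub h X \<and> X \<subseteq> V \<longrightarrow> X \<in> K)"

definition pole :: "nat \<Rightarrow> ('a::field ^ 'n) set set \<Rightarrow> ('a ^ 'n) set \<Rightarrow> ('a ^ 'n) set" where
  "pole h K V = (THE P. psub 0 P \<and> (\<forall>X. psub h X \<and> X \<subseteq> V \<longrightarrow> (X \<in> K \<longleftrightarrow> P \<subseteq> X)))"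

definition dual_polarity :: "nat \<Rightarrow> ('a::field ^ 'n) set set \<Rightarrow> ('a ^ 'n) set \<Rightarrow> ('a ^ 'n) set option" where
  "dual_polarity h K V = (if psub (Suc h) V \<and> \<not> total h K V then Some (pole h K V) else None)"

end

theory Submission
  imports Defs
begin

text \<open>
  Let \<open>K\<close> consist of the \<open>h\<close>-subspaces \<open>X\<close> such that every non-exceptional \<open>V \<supseteq> X\<close> has
  \<open>V\<^sup>\<chi> \<in> X\<close>. Looking at pencils with vertex \<open>X\<close> one sees that a single \<open>V \<supseteq> X\<close> decides
  whether \<open>X \<in> K\<close>; hence the \<open>h\<close>-subspaces of \<open>V\<close> in \<open>K\<close> are all of them, or those through \<open>V\<^sup>\<chi>\<close>.

  What remains is that such a \<open>K\<close> (a geometric hyperplane of the Grassmannian) is the zero set of an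
  alternating form. Encode \<open>K\<close> by the \<open>(h+1)\<close>-lists of vectors that are dependent or span a
  member of \<open>K\<close>; all that matters is that the set of admissible entries in each slot is a
  subspace of codimension at most one. A form is then built by adjoining one vector \<open>e\<close> to a subspace \<open>S\<close>:
  induction gives a form \<open>g\<close> for \<open>K\<close> on \<open>S\<close> and a form \<open>g'\<close> for the members through \<open>e\<close>, and
  \<open>g + l (e\<^sup>* \<and> g')\<close> is right if the scalar \<open>l\<close>, which can be read off from every list \<open>us\<close> with
  \<open>g' us \<noteq> 0\<close> and \<open>g (x # us) \<noteq> 0\<close> for some \<open>x\<close>, does not depend on \<open>us\<close>. It is unchanged when one
  entry of \<open>us\<close> is replaced, and such replacements connect all these lists if the field has more than
  two elements; over the field with two elements necessarily \<open>l = 1\<close>.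
\<close>

subsection \<open>Alternating forms on lists\<close>

text \<open>Only adjacent repeats are mentioned: neighbours can be swapped at the cost of a sign,
  which brings any two equal entries together. Lists suit inductions that fix the first entry;
  values on lists of length other than \<open>k\<close> are left free.\<close>

definition alternating :: "nat \<Rightarrow> (('a::field ^ 'n) list \<Rightarrow> 'a) \<Rightarrow> bool" where
  "alternating k f \<longleftrightarrow>
     (\<forall>as x y bs a b. length as + length bs + 1 = k \<longrightarrow>
        f (as @ (a *s x + b *s y) # bs) = a * f (as @ x # bs) + b * f (as @ y # bs)) \<and>
     (\<forall>as x bs. length as + length bs + 2 = k \<longrightarrow> f (as @ x # x # bs) = 0)"

lemma alternating_lincomb:
  assumes "alternating k f" "length as + length bs + 1 = k"
  shows "f (as @ (a *s x + b *s y) # bs) = a * f (as @ x # bs) + b * f (as @ y # bs)"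
  using assms unfolding alternating_def by blast

lemma alternating_repeat:
  assumes "alternating k f" "length as + length bs + 2 = k"
  shows "f (as @ x # x # bs) = 0"
  using assms unfolding alternating_def by blast

lemma alternating_add:
  assumes "alternating k f" "length as + length bs + 1 = k"
  shows "f (as @ (x + y) # bs) = f (as @ x # bs) + f (as @ y # bs)"
  using alternating_lincomb[OF assms, of 1 x 1 y] by simp

lemma alternating_scale:
  assumes "alternating k f" "length as + length bs + 1 = k"
  shows "f (as @ (a *s x) # bs) = a * f (as @ x # bs)"
  using alternating_lincomb[OF assms, of a x 0 x] by simp

lemma alternating_zero:
  assumes "alternating k f" "length as + length bs + 1 = k"
  shows "f (as @ 0 # bs) = 0"
  using alternating_scale[OF assms, of 0 0] by simp

lemma alternating_hd_lincomb:
  assumes "alternating (Suc k) f" "length us = k"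
  shows "f ((a *s x + b *s y) # us) = a * f (x # us) + b * f (y # us)"
  using alternating_lincomb[OF assms(1), of "[]" us] assms(2) by simp

text \<open>Contraction with a fixed vector; this is how inductions on the degree descend.\<close>

lemma alternating_contract:
  fixes f :: "('a::field ^ 'n) list \<Rightarrow> 'a"
  assumes "alternating (Suc k) f"
  shows "alternating k (\<lambda>xs. f (x # xs))"
  unfolding alternating_def
proof (intro conjI allI impI)
  fix as bs :: "('a ^ 'n) list" and y z a b assume "length as + length bs + 1 = k"
  then show "f (x # as @ (a *s y + b *s z) # bs) = a * f (x # as @ y # bs) + b * f (x # as @ z # bs)"
    using alternating_lincomb[OF assms, of "x # as" bs] by simp
next
  fix as bs :: "('a ^ 'n) list" and y assume "length as + length bs + 2 = k"
  then show "f (x # as @ y # y # bs) = 0"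
    using alternating_repeat[OF assms, of "x # as" bs] by simp
qed

text \<open>Polarization: expand the vanishing value with \<open>x + y\<close> in both neighbouring
  slots.\<close>

lemma alternating_swap:
  assumes "alternating k f" "length as + length bs + 2 = k"
  shows "f (as @ x # y # bs) = - f (as @ y # x # bs)"
proof -
  have 1: "f (as @ (x + y) # z # bs) = f (as @ x # z # bs) + f (as @ y # z # bs)" for z
    using alternating_add[OF assms(1), of as "z # bs"] assms(2) by simp
  have 2: "f (as @ z # (x + y) # bs) = f (as @ z # x # bs) + f (as @ z # y # bs)" for z
    using alternating_add[OF assms(1), of "as @ [z]" bs] assms(2) by simp
  have "f (as @ (x + y) # (x + y) # bs) = 0" "f (as @ x # x # bs) = 0" "f (as @ y # y # bs) = 0"
    using alternating_repeat[OF assms] by auto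
  then show ?thesis by (simp add: 1 2 eq_neg_iff_add_eq_0 add.commute)
qed

lemma alternating_hd_swap:
  assumes "alternating (Suc (Suc k)) f" "length us = k"
  shows "f (x # y # us) = - f (y # x # us)"
  using alternating_swap[OF assms(1), of "[]" us x y] assms(2) by simp

lemma alternating_map:
  fixes f :: "('a::field ^ 'n) list \<Rightarrow> 'a" and s :: "'a ^ 'n \<Rightarrow> 'a ^ 'n"
  assumes f: "alternating k f" and s: "\<And>a b x y. s (a *s x + b *s y) = a *s s x + b *s s y"
  shows "alternating k (\<lambda>xs. f (map s xs))"
  unfolding alternating_def
proof (intro conjI allI impI)
  fix as bs :: "('a ^ 'n) list" and y z a b assume "length as + length bs + 1 = k"
  then show "f (map s (as @ (a *s y + b *s z) # bs)) = a * f (map s (as @ y # bs)) + b * f (map s (as @ z # bs))"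
    using alternating_lincomb[OF f, of "map s as" "map s bs"] by (simp add: s)
next
  fix as bs :: "('a ^ 'n) list" and y assume "length as + length bs + 2 = k"
  then show "f (map s (as @ y # y # bs)) = 0"
    using alternating_repeat[OF f, of "map s as" "map s bs"] by simp
qed

lemma alternating_lin:
  fixes f :: "('a::field ^ 'n) list \<Rightarrow> 'a"
  assumes "alternating k f" "alternating k g"
  shows "alternating k (\<lambda>xs. f xs + c * g xs)"
  unfolding alternating_def
proof (intro conjI allI impI)
  fix as bs :: "('a ^ 'n) list" and x y a b assume "length as + length bs + 1 = k"
  then show "f (as @ (a *s x + b *s y) # bs) + c * g (as @ (a *s x + b *s y) # bs)
      = a * (f (as @ x # bs) + c * g (as @ x # bs)) + b * (f (as @ y # bs) + c * g (as @ y # bs))"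
    by (simp add: alternating_lincomb[OF assms(1)] alternating_lincomb[OF assms(2)] algebra_simps)
next
  fix as bs :: "('a ^ 'n) list" and x assume "length as + length bs + 2 = k"
  then show "f (as @ x # x # bs) + c * g (as @ x # x # bs) = 0"
    by (simp add: alternating_repeat[OF assms(1)] alternating_repeat[OF assms(2)])
qed

text \<open>The exterior product of \<open>t\<close> and \<open>g\<close> as a Laplace expansion:
  the alternating sum of \<open>t\<close> at one entry times \<open>g\<close> at the remaining ones.
  A skipped entry is absorbed into \<open>g\<close>, which produces the sign.\<close>

fun wedge :: "('a::field ^ 'n \<Rightarrow> 'a) \<Rightarrow> (('a ^ 'n) list \<Rightarrow> 'a) \<Rightarrow> ('a ^ 'n) list \<Rightarrow> 'a" where
  "wedge t g [] = 0"
| "wedge t g (x # xs) = t x * g xs - wedge t (\<lambda>ys. g (x # ys)) xs"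

lemma wedge_cong:
  "(\<And>ys. Suc (length ys) = length xs \<Longrightarrow> g ys = g' ys) \<Longrightarrow> wedge t g xs = wedge t g' xs"
proof (induction xs arbitrary: g g')
  case (Cons x xs)
  have "wedge t (\<lambda>ys. g (x # ys)) xs = wedge t (\<lambda>ys. g' (x # ys)) xs"
    by (rule Cons.IH) (simp add: Cons.prems)
  then show ?case using Cons.prems by simp
qed simp

lemma wedge_lincomb:
  "wedge t (\<lambda>ys. a * g ys + b * g' ys) xs = a * wedge t g xs + b * wedge t g' xs"
  by (induction xs arbitrary: g g') (simp_all add: algebra_simps)

lemma wedge_zero: "wedge t (\<lambda>_. 0) xs = 0"
  by (induction xs) simp_all

lemma wedge_kernel: "(\<And>x. x \<in> set xs \<Longrightarrow> t x = 0) \<Longrightarrow> wedge t g xs = 0"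
  by (induction xs arbitrary: g) simp_all

text \<open>Both conditions go by induction on the prefix \<open>as\<close>, with \<open>g\<close>
  arbitrary because the recursion contracts it. For a repeat at the front, the two terms with
  \<open>t x\<close> cancel and the rest contains \<open>g (x # x # ys) = 0\<close>.\<close>

lemma alternating_wedge:
  fixes g :: "('a::field ^ 'n) list \<Rightarrow> 'a"
  assumes g: "alternating k g" and t: "\<And>a b x y. t (a *s x + b *s y) = a * t x + b * t y"
  shows "alternating (Suc k) (wedge t g)"
  unfolding alternating_def
proof (intro conjI allI impI)
  fix as bs :: "('a ^ 'n) list" and x y a b assume "length as + length bs + 1 = Suc k"
  then show "wedge t g (as @ (a *s x + b *s y) # bs)
      = a * wedge t g (as @ x # bs) + b * wedge t g (as @ y # bs)"
    using g
  proof (induction as arbitrary: k g)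
    case Nil
    have "wedge t (\<lambda>ys. g ((a *s x + b *s y) # ys)) bs
        = wedge t (\<lambda>ys. a * g (x # ys) + b * g (y # ys)) bs"
      using alternating_lincomb[OF Nil(2), of "[]"] Nil(1) by (intro wedge_cong) simp
    then show ?case by (simp add: wedge_lincomb t algebra_simps)
  next
    case (Cons z as)
    then obtain j where j: "k = Suc j" by (cases k) auto
    have "wedge t (\<lambda>ys. g (z # ys)) (as @ (a *s x + b *s y) # bs)
      = a * wedge t (\<lambda>ys. g (z # ys)) (as @ x # bs) + b * wedge t (\<lambda>ys. g (z # ys)) (as @ y # bs)"
      using Cons.prems j by (intro Cons.IH[of j]) (auto intro: alternating_contract)
    then show ?case
      using alternating_lincomb[OF Cons.prems(2), of as bs] Cons.prems(1)
      by (simp add: algebra_simps)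
  qed
next
  fix as bs :: "('a ^ 'n) list" and x assume "length as + length bs + 2 = Suc k"
  then show "wedge t g (as @ x # x # bs) = 0"
    using g
  proof (induction as arbitrary: k g)
    case Nil
    have "wedge t (\<lambda>ys. g (x # x # ys)) bs = wedge t (\<lambda>_. 0) bs"
      using alternating_repeat[OF Nil(2), of "[]"] Nil(1) by (intro wedge_cong) simp
    then show ?case by (simp add: wedge_zero)
  next
    case (Cons z as)
    then obtain j where j: "k = Suc j" by (cases k) auto
    have "wedge t (\<lambda>ys. g (z # ys)) (as @ x # x # bs) = 0"
      using Cons.prems j by (intro Cons.IH[of j]) (auto intro: alternating_contract)
    then show ?case
      using alternating_repeat[OF Cons.prems(2), of as bs] Cons.prems(1) by simp
  qed
qed


subsection \<open>Zero sets of alternating forms\<close>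

text \<open>What can be said about the zeros of an alternating \<open>k\<close>-form on
  \<open>S\<close> without naming the form. Conditions on the first slot suffice, since
  \<open>swapI\<close> carries any entry there; \<open>hd_subspace\<close> and
  \<open>hd_codim\<close> together make the admissible heads a subspace of codimension at most
  one.\<close>

locale alt_zero_set =
  fixes k :: nat and S :: "('a::field ^ 'n) set" and Z :: "('a ^ 'n) list \<Rightarrow> bool"
  assumes subspace_S: "vec.subspace S"
    and swapI: "\<And>as x y bs. length as + length bs + 2 = k \<Longrightarrow> set (as @ x # y # bs) \<subseteq> S
      \<Longrightarrow> Z (as @ x # y # bs) \<Longrightarrow> Z (as @ y # x # bs)"
    and repeat: "\<And>x us. length us + 2 = k \<Longrightarrow> set (x # us) \<subseteq> S \<Longrightarrow> Z (x # x # us)"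
    and hd_subspace: "\<And>us. Suc (length us) = k \<Longrightarrow> set us \<subseteq> S \<Longrightarrow> vec.subspace {p \<in> S. Z (p # us)}"
    and hd_codim: "\<And>us p q. Suc (length us) = k \<Longrightarrow> set us \<subseteq> S \<Longrightarrow> p \<in> S \<Longrightarrow> q \<in> S \<Longrightarrow>
      \<exists>a b. (a \<noteq> 0 \<or> b \<noteq> 0) \<and> Z ((a *s p + b *s q) # us)"
begin

lemma swap:
  assumes "length as + length bs + 2 = k" "set (as @ x # y # bs) \<subseteq> S"
  shows "Z (as @ x # y # bs) \<longleftrightarrow> Z (as @ y # x # bs)"
  using swapI[of as bs x y] swapI[of as bs y x] assms by auto

lemma move:
  assumes "length as + length bs + length cs + 1 = k" "set (cs @ as @ x # bs) \<subseteq> S"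
  shows "Z (cs @ as @ x # bs) \<longleftrightarrow> Z (cs @ x # as @ bs)"
  using assms
proof (induction as arbitrary: cs)
  case (Cons a as)
  then show ?case using Cons.IH[of "cs @ [a]"] swap[of cs "as @ bs" a x] by auto
qed simp

lemma hd_lincomb:
  assumes "Suc (length us) = k" "set us \<subseteq> S" "x \<in> S" "y \<in> S" "Z (x # us)" "Z (y # us)"
  shows "Z ((a *s x + b *s y) # us)"
proof -
  have "vec.subspace {p \<in> S. Z (p # us)}" using hd_subspace assms by blast
  moreover have "x \<in> {p \<in> S. Z (p # us)}" "y \<in> {p \<in> S. Z (p # us)}" using assms by auto
  ultimately have "a *s x + b *s y \<in> {p \<in> S. Z (p # us)}"
    by (meson vec.subspace_add vec.subspace_scale)
  then show ?thesis by simp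
qed

lemma hd_scale_iff:
  assumes "Suc (length us) = k" "set us \<subseteq> S" "x \<in> S" "c \<noteq> 0"
  shows "Z ((c *s x) # us) \<longleftrightarrow> Z (x # us)"
proof
  assume "Z (x # us)"
  then show "Z ((c *s x) # us)" using hd_lincomb[of us x x c 0] assms by simp
next
  assume "Z ((c *s x) # us)"
  then have "Z ((inverse c *s (c *s x) + 0 *s (c *s x)) # us)"
    using assms vec.subspace_scale[OF subspace_S] by (intro hd_lincomb) auto
  then show "Z (x # us)" using assms by simp
qed

lemma hd_shift_iff:
  assumes "Suc (length us) = k" "set us \<subseteq> S" "x \<in> S" "y \<in> S" "Z (y # us)"
  shows "Z ((x + c *s y) # us) \<longleftrightarrow> Z (x # us)"
proof
  assume "Z (x # us)"
  then show "Z ((x + c *s y) # us)" using hd_lincomb[of us x y 1 c] assms by simp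
next
  assume "Z ((x + c *s y) # us)"
  then have "Z ((1 *s (x + c *s y) + (- c) *s y) # us)"
    using assms vec.subspace_scale[OF subspace_S] vec.subspace_add[OF subspace_S]
    by (intro hd_lincomb) auto
  then show "Z (x # us)" by (simp add: vec.scale_minus_left)
qed

lemma reduce_entry:
  assumes "length as + length bs + 2 = k" "set (x # as @ y # bs) \<subseteq> S"
  shows "Z (x # as @ (y - c *s x) # bs) \<longleftrightarrow> Z (x # as @ y # bs)"
proof -
  have S: "y - c *s x \<in> S"
    using assms(2) vec.subspace_scale[OF subspace_S] vec.subspace_diff[OF subspace_S] by auto
  have m: "Z (x # as @ z # bs) \<longleftrightarrow> Z (z # x # as @ bs)" if "z \<in> S" for z
    using move[of "x # as" bs "[]" z] assms that by auto
  have "Z ((y + (- c) *s x) # x # as @ bs) \<longleftrightarrow> Z (y # x # as @ bs)"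
    using assms repeat[of "as @ bs" x] by (intro hd_shift_iff) auto
  then show ?thesis using m S assms by (simp add: vec.scale_minus_left)
qed

text \<open>Gaussian elimination with the head as pivot: since \<open>x # x # us\<close> is
  admissible, subtracting multiples of \<open>x\<close> from later entries changes nothing. The
  prefix \<open>as\<close> holds the entries that the induction has already passed.\<close>

lemma reduce:
  assumes "Suc (length as + length bs) = k" "set (x # as @ bs) \<subseteq> S"
  shows "Z (x # as @ map (\<lambda>y. y - c y *s x) bs) \<longleftrightarrow> Z (x # as @ bs)"
  using assms
proof (induction bs arbitrary: as)
  case (Cons b bs)
  have S: "y - c y *s x \<in> S" if "y \<in> S" for y
    using that Cons.prems(2) vec.subspace_scale[OF subspace_S] vec.subspace_diff[OF subspace_S] by auto
  have "Z (x # as @ map (\<lambda>y. y - c y *s x) (b # bs)) \<longleftrightarrow>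
      Z (x # (as @ [b - c b *s x]) @ map (\<lambda>y. y - c y *s x) bs)" by simp
  also have "\<dots> \<longleftrightarrow> Z (x # (as @ [b - c b *s x]) @ bs)"
    using Cons.prems S by (intro Cons.IH) auto
  also have "\<dots> \<longleftrightarrow> Z (x # as @ b # bs)" using reduce_entry[of as bs x b "c b"] Cons.prems by simp
  finally show ?case .
qed simp

lemma not_distinct:
  assumes "length xs = k" "set xs \<subseteq> S" "\<not> distinct xs"
  shows "Z xs"
proof -
  obtain as bs cs x where xs: "xs = as @ [x] @ bs @ [x] @ cs"
    using not_distinct_decomp[OF assms(3)] by blast
  have "Z (x # x # as @ bs @ cs)" using assms xs by (intro repeat) auto
  then have "Z (x # as @ x # bs @ cs)" using move[of as "bs @ cs" "[x]" x] assms xs by auto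
  then have "Z (as @ x # x # bs @ cs)" using move[of as "x # bs @ cs" "[]" x] assms xs by auto
  then show ?thesis using move[of bs cs "as @ [x]" x] assms xs by auto
qed

text \<open>The members through \<open>e\<close> form a structure of the same kind in one degree
  less; swapping \<open>e\<close> with the next entry transfers the head conditions.\<close>

lemma contract:
  assumes "k = Suc j" "e \<in> S" "vec.subspace T" "T \<subseteq> S"
  shows "alt_zero_set j T (\<lambda>xs. Z (e # xs))"
proof
  show "vec.subspace T" by fact
next
  fix as x y bs
  assume "length as + length bs + 2 = j" "set (as @ x # y # bs) \<subseteq> T" "Z (e # as @ x # y # bs)"
  then show "Z (e # as @ y # x # bs)" using swap[of "e # as" bs x y] assms by auto
next
  fix x us assume "length us + 2 = j" "set (x # us) \<subseteq> T"
  then show "Z (e # x # x # us)" using assms by (intro not_distinct) auto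
next
  fix us assume us: "Suc (length us) = j" "set us \<subseteq> T"
  have m: "Z (e # p # us) \<longleftrightarrow> Z (p # e # us)" if "p \<in> T" for p
    using swap[of "[]" us e p] us that assms by auto
  have "vec.subspace (T \<inter> {p \<in> S. Z (p # e # us)})"
    using us assms by (intro vec.subspace_inter hd_subspace) auto
  moreover have "T \<inter> {p \<in> S. Z (p # e # us)} = {p \<in> T. Z (e # p # us)}" using m assms by auto
  ultimately show "vec.subspace {p \<in> T. Z (e # p # us)}" by simp
next
  fix us p q assume us: "Suc (length us) = j" "set us \<subseteq> T" "p \<in> T" "q \<in> T"
  have m: "Z (e # p # us) \<longleftrightarrow> Z (p # e # us)" if "p \<in> T" for p
    using swap[of "[]" us e p] us that assms by auto
  obtain a b where "a \<noteq> 0 \<or> b \<noteq> 0" "Z ((a *s p + b *s q) # e # us)"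
    using hd_codim[of "e # us" p q] us assms by (auto simp: subset_iff)
  moreover have "a *s p + b *s q \<in> T"
    using us assms by (simp add: vec.subspace_add vec.subspace_scale)
  ultimately show "\<exists>a b. (a \<noteq> 0 \<or> b \<noteq> 0) \<and> Z (e # (a *s p + b *s q) # us)" using m by blast
qed

lemma restrict:
  assumes "vec.subspace T" "T \<subseteq> S"
  shows "alt_zero_set k T Z"
proof
  show "vec.subspace T" by fact
next
  fix us assume us: "Suc (length us) = k" "set us \<subseteq> T"
  have "vec.subspace (T \<inter> {p \<in> S. Z (p # us)})"
    using us assms by (intro vec.subspace_inter hd_subspace) auto
  moreover have "T \<inter> {p \<in> S. Z (p # us)} = {p \<in> T. Z (p # us)}" using assms by auto
  ultimately show "vec.subspace {p \<in> T. Z (p # us)}" by simp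
next
  fix as x y bs
  assume "length as + length bs + 2 = k" "set (as @ x # y # bs) \<subseteq> T" "Z (as @ x # y # bs)"
  then show "Z (as @ y # x # bs)" using assms(2) by (intro swapI[of as bs x y]) auto
next
  fix x us assume "length us + 2 = k" "set (x # us) \<subseteq> T"
  then show "Z (x # x # us)" using assms(2) by (intro repeat) auto
next
  fix us p q assume "Suc (length us) = k" "set us \<subseteq> T" "p \<in> T" "q \<in> T"
  then show "\<exists>a b. (a \<noteq> 0 \<or> b \<noteq> 0) \<and> Z ((a *s p + b *s q) # us)"
    using assms(2) by (intro hd_codim) auto
qed

end

text \<open>The intended model of the locale, so that moving and elimination are also available for
  forms. In \<open>hd_codim\<close> the coefficients are the values of \<open>f\<close> at
  \<open>q\<close> and, negated, at \<open>p\<close>.\<close>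

lemma alt_zero_set_alternating:
  fixes f :: "('a::field ^ 'n) list \<Rightarrow> 'a"
  assumes f: "alternating k f" and S: "vec.subspace S"
  shows "alt_zero_set k S (\<lambda>xs. f xs = 0)"
proof
  fix as x y bs assume "length as + length bs + 2 = k" "f (as @ x # y # bs) = 0"
  then show "f (as @ y # x # bs) = 0" using alternating_swap[OF f, of as bs y x] by simp
next
  fix us :: "('a ^ 'n) list" and x assume "length us + 2 = k"
  then show "f (x # x # us) = 0" using alternating_repeat[OF f, of "[]" us] by simp
next
  fix us :: "('a ^ 'n) list" assume us: "Suc (length us) = k" "set us \<subseteq> S"
  then show "vec.subspace {p \<in> S. f (p # us) = 0}"
    using S alternating_add[OF f, of "[]" us] alternating_scale[OF f, of "[]" us]
      alternating_zero[OF f, of "[]" us]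
    by (auto simp: vec.subspace_def)
next
  fix us :: "('a ^ 'n) list" and p q assume us: "Suc (length us) = k"
  have *: "f ((a *s p + b *s q) # us) = a * f (p # us) + b * f (q # us)" for a b
    using alternating_lincomb[OF f, of "[]" us] us by simp
  show "\<exists>a b. (a \<noteq> 0 \<or> b \<noteq> 0) \<and> f ((a *s p + b *s q) # us) = 0"
  proof (cases "f (p # us) = 0")
    case True
    then show ?thesis using *[of 1 0] by (intro exI[of _ 1] exI[of _ 0]) simp
  next
    case False
    then show ?thesis using *[of "f (q # us)" "- f (p # us)"]
      by (intro exI[of _ "f (q # us)"] exI[of _ "- f (p # us)"]) simp
  qed
qed (rule S)

text \<open>Elimination brings every list over the larger span either into the span of
  \<open>B\<close> or to a list whose head is congruent to \<open>e\<close> and whose tail lies in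
  the span of \<open>B\<close>. So agreement on these two kinds is enough.\<close>

lemma alt_zero_set_agree:
  assumes Z1: "alt_zero_set k (vec.span (insert e B)) Z1"
    and Z2: "alt_zero_set k (vec.span (insert e B)) Z2"
    and base: "\<And>xs. length xs = k \<Longrightarrow> set xs \<subseteq> vec.span B \<Longrightarrow> Z1 xs \<longleftrightarrow> Z2 xs"
    and step: "\<And>x us. Suc (length us) = k \<Longrightarrow> x \<in> vec.span B \<Longrightarrow> set us \<subseteq> vec.span B \<Longrightarrow>
      Z1 ((x + e) # us) \<longleftrightarrow> Z2 ((x + e) # us)"
    and xs: "length xs = k" "set xs \<subseteq> vec.span (insert e B)"
  shows "Z1 xs \<longleftrightarrow> Z2 xs"
proof -
  let ?S = "vec.span B" and ?T = "vec.span (insert e B)"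
  interpret Z1: alt_zero_set k ?T Z1 by fact
  interpret Z2: alt_zero_set k ?T Z2 by fact
  have "\<forall>y\<in>?T. \<exists>c. y - c *s e \<in> ?S" by (auto simp: vec.span_insert)
  \<comment> \<open>\<open>c y\<close> is an \<open>e\<close>-coordinate of \<open>y\<close> modulo
    the span of \<open>B\<close>; an arbitrary choice for each \<open>y\<close> will do.\<close>
  then obtain c where c: "\<And>y. y \<in> ?T \<Longrightarrow> y - c y *s e \<in> ?S" by metis
  show ?thesis
  proof (cases "\<forall>x\<in>set xs. c x = 0")
    case True
    then have "set xs \<subseteq> ?S" using c xs by fastforce
    then show ?thesis using base xs by blast
  next
    case False
    then obtain as x bs where x: "c x \<noteq> 0" "xs = as @ x # bs" by (meson split_list)
    \<comment> \<open>An entry with nonzero coordinate is normalised to coordinate 1; as pivot it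
      then clears the coordinates of all other entries.\<close>
    define y where "y = inverse (c x) *s x"
    define s where "s = inverse (c x) *s (x - c x *s e)"
    have xT: "x \<in> ?T" and abT: "set (as @ bs) \<subseteq> ?T" using x xs by auto
    have sS: "s \<in> ?S" unfolding s_def using c[OF xT] by (rule vec.span_scale)
    have y: "y = s + e" using x by (simp add: y_def s_def vec.scale_right_diff_distrib)
    have yT: "y \<in> ?T" unfolding y_def using xT by (rule vec.span_scale)
    have len: "Suc (length (as @ bs)) = k" using xs x by simp
    let ?us = "map (\<lambda>z. z - c z *s y) (as @ bs)"
    have us: "set ?us \<subseteq> ?S"
    proof
      fix w assume "w \<in> set ?us"
      then obtain z where z: "z \<in> ?T" "w = z - c z *s y" using abT by auto
      then have "w = (z - c z *s e) - c z *s s" by (simp add: y vec.scale_right_distrib)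
      then show "w \<in> ?S" using c[OF z(1)] sS by (simp add: vec.span_diff vec.span_scale)
    qed
    have "Z1 xs \<longleftrightarrow> Z1 (x # as @ bs)" using Z1.move[of as bs "[]" x] x xs by simp
    also have "\<dots> \<longleftrightarrow> Z1 (y # as @ bs)" unfolding y_def using Z1.hd_scale_iff[of "as @ bs" x] x xT abT len by auto
    also have "\<dots> \<longleftrightarrow> Z1 (y # ?us)" using Z1.reduce[of "[]" "as @ bs" y c] yT abT len by auto
    also have "\<dots> \<longleftrightarrow> Z2 (y # ?us)" unfolding y using step[of ?us s] us sS len y by auto
    also have "\<dots> \<longleftrightarrow> Z2 (y # as @ bs)" using Z2.reduce[of "[]" "as @ bs" y c] yT abT len by auto
    also have "\<dots> \<longleftrightarrow> Z2 (x # as @ bs)" unfolding y_def using Z2.hd_scale_iff[of "as @ bs" x] x xT abT len by auto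
    also have "\<dots> \<longleftrightarrow> Z2 xs" using Z2.move[of as bs "[]" x] x xs by simp
    finally show ?thesis .
  qed
qed

text \<open>Expanding by multilinearity expresses \<open>f zs\<close> through the values at sublists
  of \<open>xs\<close> of length \<open>r\<close>. Instead of writing out minors, the zero set of
  \<open>f\<close> is compared with that of the zero form.\<close>

lemma alternating_vanish_span:
  assumes "alternating r f" "\<And>ys. ys \<in> set (subseqs xs) \<Longrightarrow> length ys = r \<Longrightarrow> f ys = 0"
    "length zs = r" "set zs \<subseteq> vec.span (set xs)"
  shows "f zs = 0"
  using assms
proof (induction xs arbitrary: r f zs)
  case Nil
  show ?case
  proof (cases zs)
    case Nil
    then show ?thesis using Nil.prems by simp
  next
    case (Cons z zs')
    then show ?thesis using Nil.prems alternating_zero[OF Nil.prems(1), of "[]" zs'] by simp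
  qed
next
  case (Cons x xs)
  have sub: "ys \<in> set (subseqs (x # xs))" if "ys \<in> set (subseqs xs)" for ys
    using that by (simp add: Let_def)
  have base: "f ys = 0" if "length ys = r" "set ys \<subseteq> vec.span (set xs)" for ys
    using Cons.IH[OF Cons.prems(1) Cons.prems(2)[OF sub] that] by simp
  have step: "f ((s + x) # us) = 0"
    if us: "Suc (length us) = r" "s \<in> vec.span (set xs)" "set us \<subseteq> vec.span (set xs)" for s us
  proof -
    have "f (x # us) = 0"
    proof (rule Cons.IH[of "length us" "\<lambda>ys. f (x # ys)"])
      show "alternating (length us) (\<lambda>ys. f (x # ys))"
        using Cons.prems(1) us(1) by (intro alternating_contract) simp
      show "f (x # ys) = 0" if "ys \<in> set (subseqs xs)" "length ys = length us" for ys
        using that us(1) by (intro Cons.prems(2)) (auto simp: Let_def)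
    qed (use us in auto)
    moreover have "f (s # us) = 0" using us by (intro base) auto
    ultimately show ?thesis using alternating_add[OF Cons.prems(1), of "[]" us] us by simp
  qed
  \<comment> \<open>The constant \<open>True\<close> stands for the zero set of the zero
    form.\<close>
  have "f zs = 0 \<longleftrightarrow> True"
  proof (rule alt_zero_set_agree[where k = r and e = x and B = "set xs"])
    show "alt_zero_set r (vec.span (insert x (set xs))) (\<lambda>xs. f xs = 0)"
      using Cons.prems(1) by (intro alt_zero_set_alternating) auto
    have "alternating r (\<lambda>_. 0 :: 'a)" by (simp add: alternating_def)
    from alt_zero_set_alternating[OF this, of "vec.span (insert x (set xs))"]
    show "alt_zero_set r (vec.span (insert x (set xs))) (\<lambda>_. True)" by simp
    show "length zs = r" "set zs \<subseteq> vec.span (insert x (set xs))" using Cons.prems by auto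
  qed (simp_all add: base step)
  then show ?case by simp
qed

subsection \<open>Lists on which two forms do not vanish\<close>

definition functional :: "('a::field ^ 'n \<Rightarrow> 'a) \<Rightarrow> bool" where
  "functional t \<longleftrightarrow> (\<forall>a b x y. t (a *s x + b *s y) = a * t x + b * t y)"

lemma functional_lincomb: "functional t \<Longrightarrow> t (a *s x + b *s y) = a * t x + b * t y"
  by (simp add: functional_def)

lemma functional_add: "functional t \<Longrightarrow> t (x + y) = t x + t y"
  using functional_lincomb[of t 1 x 1 y] by simp

lemma functional_scale: "functional t \<Longrightarrow> t (a *s x) = a * t x"
  using functional_lincomb[of t a x 0 x] by simp

lemma functional_diff: "functional t \<Longrightarrow> t (x - y) = t x - t y"
  using functional_lincomb[of t 1 x "-1" y] by (simp add: vec.scale_minus_left)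

lemma functional_uminus: "functional t \<Longrightarrow> t (- x) = - t x"
  using functional_lincomb[of t 0 x "-1" x] by (simp add: vec.scale_minus_left)

lemma alternating_functional:
  assumes "alternating k f" "length as + length bs + 1 = k"
  shows "functional (\<lambda>w. f (as @ w # bs))"
  unfolding functional_def by (intro allI alternating_lincomb[OF assms])

text \<open>A vector space is not the union of two proper subspaces: \<open>x\<close>,
  \<open>y\<close> or \<open>x + y\<close> avoids both kernels.\<close>

lemma functionals2_nonzero:
  assumes S: "vec.subspace S" and \<alpha>: "functional \<alpha>" "x \<in> S" "\<alpha> x \<noteq> 0"
    and \<beta>: "functional \<beta>" "y \<in> S" "\<beta> y \<noteq> 0"
  shows "\<exists>w\<in>S. \<alpha> w \<noteq> 0 \<and> \<beta> w \<noteq> 0"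
proof (cases "\<beta> x = 0 \<and> \<alpha> y = 0")
  case True
  then show ?thesis using assms vec.subspace_add[OF S \<alpha>(2) \<beta>(2)]
    by (intro bexI[of _ "x + y"]) (simp_all add: functional_add)
qed (use assms in blast)

text \<open>Three hyperplanes can cover a space over the field with two elements. A scalar
  \<open>c\<close> other than 0 and 1 leaves two candidates on the line \<open>w0 + t *s z0\<close>,
  and at most one of them is killed by \<open>\<alpha>\<close>.\<close>

lemma functionals3_nonzero:
  assumes S: "vec.subspace S" and F: "c \<noteq> (0 :: 'a::field)" "c \<noteq> 1"
    and \<alpha>: "functional \<alpha>" "x \<in> S" "\<alpha> x \<noteq> (0 :: 'a)"
    and \<beta>: "functional \<beta>" "y \<in> S" "\<beta> y \<noteq> 0"
    and \<gamma>: "functional \<gamma>" "z \<in> S" "\<gamma> z \<noteq> 0"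
  shows "\<exists>w\<in>S. \<alpha> w \<noteq> 0 \<and> \<beta> w \<noteq> 0 \<and> \<gamma> w \<noteq> 0"
proof -
  obtain w0 where w0: "w0 \<in> S" "\<alpha> w0 \<noteq> 0" "\<beta> w0 \<noteq> 0" using functionals2_nonzero[OF S \<alpha> \<beta>] by blast
  obtain z0 where z0: "z0 \<in> S" "\<alpha> z0 \<noteq> 0" "\<gamma> z0 \<noteq> 0" using functionals2_nonzero[OF S \<alpha> \<gamma>] by blast
  show ?thesis
  proof (cases "\<gamma> w0 = 0 \<and> \<beta> z0 = 0")
    case True
    have "\<exists>t. t \<noteq> 0 \<and> \<alpha> w0 + t * \<alpha> z0 \<noteq> 0"
    proof (cases "\<alpha> w0 + \<alpha> z0 = 0")
      case True
      then have "\<alpha> w0 = - \<alpha> z0" by (simp add: eq_neg_iff_add_eq_0)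
      then have "\<alpha> w0 + c * \<alpha> z0 = (c - 1) * \<alpha> z0" by (simp add: algebra_simps)
      then show ?thesis using F z0 by (intro exI[of _ c]) simp
    qed (auto intro: exI[of _ 1])
    then obtain t where t: "t \<noteq> 0" "\<alpha> w0 + t * \<alpha> z0 \<noteq> 0" by blast
    have "w0 + t *s z0 \<in> S" using w0 z0 S by (simp add: vec.subspace_add vec.subspace_scale)
    then show ?thesis using True t w0 z0 \<alpha>(1) \<beta>(1) \<gamma>(1)
      by (intro bexI[of _ "w0 + t *s z0"]) (simp_all add: functional_add functional_scale)
  qed (use w0 z0 in blast)
qed

text \<open>Four hyperplanes may cover a space over the field with three elements, but three
  hyperplanes and one subspace of codimension two cannot. The vectors \<open>p\<close> and
  \<open>q\<close> witness that \<open>\<delta>1\<close> and \<open>\<delta>2\<close> are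
  independent on \<open>S\<close>.\<close>

lemma functionals4_nonzero:
  assumes S: "vec.subspace S" and F: "c \<noteq> (0 :: 'a::field)" "c \<noteq> 1"
    and \<alpha>: "functional \<alpha>" "x \<in> S" "\<alpha> x \<noteq> (0 :: 'a)"
    and \<beta>: "functional \<beta>" "y \<in> S" "\<beta> y \<noteq> 0"
    and \<gamma>: "functional \<gamma>" "z \<in> S" "\<gamma> z \<noteq> 0"
    and \<delta>: "functional \<delta>1" "functional \<delta>2" "p \<in> S" "q \<in> S" "\<delta>1 p \<noteq> 0" "\<delta>1 q = 0" "\<delta>2 p = 0" "\<delta>2 q \<noteq> 0"
  shows "\<exists>w\<in>S. \<alpha> w \<noteq> 0 \<and> \<beta> w \<noteq> 0 \<and> \<gamma> w \<noteq> 0 \<and> (\<delta>1 w \<noteq> 0 \<or> \<delta>2 w \<noteq> 0)"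
proof -
  obtain w where w: "w \<in> S" "\<alpha> w \<noteq> 0" "\<beta> w \<noteq> 0" "\<gamma> w \<noteq> 0"
    using functionals3_nonzero[OF S F \<alpha> \<beta> \<gamma>] by blast
  show ?thesis
  proof (cases "\<delta>1 w = 0 \<and> \<delta>2 w = 0")
    case True
    \<comment> \<open>Moving \<open>w\<close> along such a \<open>y\<close> keeps
      \<open>\<alpha>\<close> and \<open>\<beta>\<close> and leaves the common kernel of
      \<open>\<delta>1\<close> and \<open>\<delta>2\<close>; only one value of \<open>t\<close> is
      then forbidden by \<open>\<gamma>\<close>.\<close>
    have "\<exists>y\<in>S. \<alpha> y = 0 \<and> \<beta> y = 0 \<and> (\<delta>1 y \<noteq> 0 \<or> \<delta>2 y \<noteq> 0)"
    proof (rule ccontr)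
      assume neg: "\<not> ?thesis"
      have comb: "\<alpha> v = 0 \<Longrightarrow> \<beta> v = 0 \<Longrightarrow> v \<in> S \<Longrightarrow> \<delta>1 v = 0 \<and> \<delta>2 v = 0" for v
        using neg by blast
      define D where "D = \<alpha> p * \<beta> q - \<alpha> q * \<beta> p"
      have inS: "a *s p + b *s q \<in> S" for a b using \<delta> S by (simp add: vec.subspace_add vec.subspace_scale)
      have "D \<noteq> 0"
      proof
        assume "D = 0"
        have inS': "a *s p - b *s q \<in> S" for a b
          using \<delta> S by (simp add: vec.subspace_diff vec.subspace_scale)
        have "\<alpha> (\<beta> q *s p - \<beta> p *s q) = 0" "\<beta> (\<beta> q *s p - \<beta> p *s q) = 0"
          "\<alpha> (\<alpha> q *s p - \<alpha> p *s q) = 0" "\<beta> (\<alpha> q *s p - \<alpha> p *s q) = 0"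
          using \<open>D = 0\<close> \<alpha>(1) \<beta>(1)
          by (simp_all add: functional_diff functional_scale D_def mult.commute)
        then have "\<delta>1 (\<beta> q *s p - \<beta> p *s q) = 0" "\<delta>2 (\<beta> q *s p - \<beta> p *s q) = 0"
          "\<delta>1 (\<alpha> q *s p - \<alpha> p *s q) = 0" "\<delta>2 (\<alpha> q *s p - \<alpha> p *s q) = 0"
          using comb[OF _ _ inS'] by blast+
        then have "\<alpha> p = 0" "\<beta> p = 0" using \<delta>
          by (simp_all add: functional_diff functional_scale functional_uminus)
        then show False using comb[of p] \<delta> by blast
      qed
      \<comment> \<open>Cramer's rule: \<open>a *s p + b *s q\<close> has the same
        \<open>\<alpha>\<close> and \<open>\<beta>\<close> as \<open>w\<close>. The difference lies
        in both kernels, hence in those of \<open>\<delta>1\<close> and \<open>\<delta>2\<close>,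
        which forces \<open>a = b = 0\<close> and \<open>\<alpha> w = 0\<close>.\<close>
      define a where "a = (\<alpha> w * \<beta> q - \<alpha> q * \<beta> w) / D"
      define b where "b = (\<alpha> p * \<beta> w - \<alpha> w * \<beta> p) / D"
      have "D * (a * \<alpha> p + b * \<alpha> q) = D * \<alpha> w" "D * (a * \<beta> p + b * \<beta> q) = D * \<beta> w"
        using \<open>D \<noteq> 0\<close> by (simp_all add: a_def b_def distrib_left) (simp_all add: D_def algebra_simps)
      then have ab: "a * \<alpha> p + b * \<alpha> q = \<alpha> w" "a * \<beta> p + b * \<beta> q = \<beta> w" using \<open>D \<noteq> 0\<close> by auto
      have "\<alpha> (w - (a *s p + b *s q)) = 0" "\<beta> (w - (a *s p + b *s q)) = 0"
        using ab \<alpha>(1) \<beta>(1) by (simp_all add: functional_diff functional_lincomb)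
      then have "\<delta>1 (w - (a *s p + b *s q)) = 0" "\<delta>2 (w - (a *s p + b *s q)) = 0"
        using comb w inS S by (simp_all add: vec.subspace_diff)
      then have "a = 0" "b = 0" using True \<delta>
        by (simp_all add: functional_diff functional_add functional_scale)
      then show False using ab w by simp
    qed
    then obtain y where y: "y \<in> S" "\<alpha> y = 0" "\<beta> y = 0" "\<delta>1 y \<noteq> 0 \<or> \<delta>2 y \<noteq> 0" by blast
    have "\<exists>t. t \<noteq> 0 \<and> \<gamma> w + t * \<gamma> y \<noteq> 0"
    proof (cases "\<gamma> w + \<gamma> y = 0")
      case True
      then have "\<gamma> w = - \<gamma> y" by (simp add: eq_neg_iff_add_eq_0)
      then have "\<gamma> w + c * \<gamma> y = (c - 1) * \<gamma> y" "\<gamma> y \<noteq> 0" using w by (auto simp: algebra_simps)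
      then show ?thesis using F by (intro exI[of _ c]) simp
    qed (auto intro: exI[of _ 1])
    then obtain t where t: "t \<noteq> 0" "\<gamma> w + t * \<gamma> y \<noteq> 0" by blast
    have "w + t *s y \<in> S" using w y S by (simp add: vec.subspace_add vec.subspace_scale)
    then show ?thesis using True t w y \<alpha>(1) \<beta>(1) \<gamma>(1) \<delta>(1,2)
      by (intro bexI[of _ "w + t *s y"]) (simp_all add: functional_add functional_scale)
  qed (use w in blast)
qed

text \<open>The lists from which the scalar \<open>l\<close> can be read off, with
  \<open>\<phi>\<close> in the role of \<open>g'\<close> and \<open>\<psi>\<close> in that of
  \<open>g\<close>.\<close>

definition good :: "('a::field ^ 'n) set \<Rightarrow> nat \<Rightarrow> (('a ^ 'n) list \<Rightarrow> 'a) \<Rightarrow> (('a ^ 'n) list \<Rightarrow> 'a) \<Rightarrow> ('a ^ 'n) list \<Rightarrow> bool" where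
  "good S r \<phi> \<psi> us \<longleftrightarrow> length us = r \<and> set us \<subseteq> S \<and> \<phi> us \<noteq> 0 \<and> (\<exists>x\<in>S. \<psi> (x # us) \<noteq> 0)"

lemma good_contract:
  assumes "alternating (Suc (Suc r)) \<psi>"
  shows "good S (Suc r) \<phi> \<psi> (u # us) \<longleftrightarrow> u \<in> S \<and> good S r (\<lambda>xs. \<phi> (u # xs)) (\<lambda>xs. \<psi> (u # xs)) us"
proof (cases "length us = r")
  case True
  then have "\<psi> (x # u # us) = - \<psi> (u # x # us)" for x
    using alternating_hd_swap[OF assms, of us x u] by simp
  then show ?thesis by (auto simp: good_def)
qed (simp add: good_def)

lemma good_swap:
  assumes "alternating r \<phi>" "alternating (Suc r) \<psi>" "good S r \<phi> \<psi> (as @ x # y # bs)"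
  shows "good S r \<phi> \<psi> (as @ y # x # bs)"
proof -
  have len: "length as + length bs + 2 = r" using assms(3) by (simp add: good_def)
  have "\<phi> (as @ x # y # bs) = - \<phi> (as @ y # x # bs)" using alternating_swap[OF assms(1) len, of x y] by simp
  moreover have "\<psi> (z # as @ x # y # bs) = - \<psi> (z # as @ y # x # bs)" for z
    using alternating_swap[OF assms(2), of "z # as" bs x y] len by simp
  ultimately show ?thesis using assms(3) by (auto simp: good_def)
qed

text \<open>The entries are chosen one by one, each so that the contractions of both forms remain
  nonzero.\<close>

lemma good_exists:
  assumes S: "vec.subspace S" and "alternating r \<phi>" "alternating (Suc r) \<psi>"
    "length xs = r" "set xs \<subseteq> S" "\<phi> xs \<noteq> 0" "length ys = Suc r" "set ys \<subseteq> S" "\<psi> ys \<noteq> 0"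
  shows "\<exists>us. good S r \<phi> \<psi> us"
  using assms(2-)
proof (induction r arbitrary: \<phi> \<psi> xs ys)
  case 0
  then show ?case by (auto simp: good_def length_Suc_conv)
next
  case (Suc r)
  obtain x xs' y ys' where xs: "xs = x # xs'" and ys: "ys = y # ys'"
    using Suc.prems by (metis length_Suc_conv)
  have "functional (\<lambda>w. \<phi> (w # xs'))" "functional (\<lambda>w. \<psi> (w # ys'))"
    using alternating_functional[OF Suc.prems(1), of "[]" xs']
      alternating_functional[OF Suc.prems(2), of "[]" ys'] Suc.prems xs ys by auto
  then obtain w where w: "w \<in> S" "\<phi> (w # xs') \<noteq> 0" "\<psi> (w # ys') \<noteq> 0"
    using functionals2_nonzero[OF S, of "\<lambda>w. \<phi> (w # xs')" x "\<lambda>w. \<psi> (w # ys')" y] Suc.prems xs ys by auto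
  have "\<exists>us. good S r (\<lambda>xs. \<phi> (w # xs)) (\<lambda>xs. \<psi> (w # xs)) us"
    using Suc.prems xs ys w
    by (intro Suc.IH[of _ _ xs' ys'] alternating_contract[OF Suc.prems(1)] alternating_contract[OF Suc.prems(2)]) auto
  then show ?case using good_contract[OF Suc.prems(2)] w by blast
qed

text \<open>
  Induction on \<open>r\<close> handles good lists with the same head. To pass from head \<open>u\<close> to head \<open>v\<close>, pick \<open>w\<close>
  such that both \<open>u, w\<close> and \<open>v, w\<close> extend to good lists; over the field with three elements such
  a \<open>w\<close> exists only because the radical of a form of degree at least two has codimension at least two.
\<close>
lemma good_connected:
  assumes S: "vec.subspace S" and F: "c \<noteq> (0 :: 'a::field)" "c \<noteq> 1"
    and "alternating r (\<phi> :: ('a ^ 'n) list \<Rightarrow> 'a)" "alternating (Suc r) \<psi>"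
    and "\<And>as x y bs. good S r \<phi> \<psi> (as @ x # y # bs) \<Longrightarrow> L (as @ x # y # bs) = L (as @ y # x # bs)"
    and "\<And>u v T. good S r \<phi> \<psi> (u # T) \<Longrightarrow> good S r \<phi> \<psi> (v # T) \<Longrightarrow> L (u # T) = L (v # T)"
    and "good S r \<phi> \<psi> us" "good S r \<phi> \<psi> vs"
  shows "L us = L vs"
  using assms(4-)
proof (induction r arbitrary: \<phi> \<psi> L us vs)
  case 0
  then show ?case by (simp add: good_def)
next
  case (Suc r)
  note \<phi> = Suc.prems(1) and \<psi> = Suc.prems(2) and swap = Suc.prems(3) and exch = Suc.prems(4)
  have hd_swap: "L (x # y # bs) = L (y # x # bs)" if "good S (Suc r) \<phi> \<psi> (x # y # bs)" for x y bs
    using swap[of "[]"] that by simp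
  \<comment> \<open>This is the induction hypothesis for the forms contracted with \<open>w\<close>;
    an exchange behind \<open>w\<close> is an exchange at the head after a swap.\<close>
  have fixed_hd: "L (w # xs) = L (w # ys)"
    if g: "good S (Suc r) \<phi> \<psi> (w # xs)" "good S (Suc r) \<phi> \<psi> (w # ys)" for w xs ys
  proof (rule Suc.IH[of "\<lambda>xs. \<phi> (w # xs)" "\<lambda>xs. \<psi> (w # xs)" "\<lambda>xs. L (w # xs)"])
    have w: "w \<in> S" using g(1) by (simp add: good_def)
    note iff = good_contract[OF \<psi>, where u = w and S = S and \<phi> = \<phi>]
    show "good S r (\<lambda>xs. \<phi> (w # xs)) (\<lambda>xs. \<psi> (w # xs)) xs" using g iff by blast
    show "good S r (\<lambda>xs. \<phi> (w # xs)) (\<lambda>xs. \<psi> (w # xs)) ys" using g iff by blast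
    show "L (w # as @ x # y # bs) = L (w # as @ y # x # bs)"
      if "good S r (\<lambda>xs. \<phi> (w # xs)) (\<lambda>xs. \<psi> (w # xs)) (as @ x # y # bs)" for as x y bs
      using swap[of "w # as"] that iff w by simp
    show "L (w # u # T) = L (w # v # T)"
      if "good S r (\<lambda>xs. \<phi> (w # xs)) (\<lambda>xs. \<psi> (w # xs)) (u # T)"
        "good S r (\<lambda>xs. \<phi> (w # xs)) (\<lambda>xs. \<psi> (w # xs)) (v # T)" for u v T
    proof -
      have gu: "good S (Suc r) \<phi> \<psi> (w # u # T)" "good S (Suc r) \<phi> \<psi> (w # v # T)"
        using that iff w by auto
      then have "good S (Suc r) \<phi> \<psi> (u # w # T)" "good S (Suc r) \<phi> \<psi> (v # w # T)"
        using good_swap[OF \<phi> \<psi>, of S "[]"] by auto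
      then have "L (u # w # T) = L (v # w # T)" by (rule exch)
      then show ?thesis using hd_swap gu by simp
    qed
  qed (intro alternating_contract \<phi> \<psi>)+
  obtain u us1 v vs1 where us: "us = u # us1" and vs: "vs = v # vs1" and len1: "length us1 = r" "length vs1 = r"
    using Suc.prems(5,6) by (auto simp: good_def length_Suc_conv)
  show ?case
  proof (cases r)
    case 0
    then show ?thesis using exch[of u "[]" v] Suc.prems(5,6) us vs len1 by simp
  next
    case (Suc r')
    then obtain u2 us2 v2 vs2 where us1: "us1 = u2 # us2" and vs1: "vs1 = v2 # vs2"
      and len2: "length us2 = r'" "length vs2 = r'"
      using len1 by (auto simp: length_Suc_conv)
    obtain x where x: "x \<in> S" "\<psi> (x # u # u2 # us2) \<noteq> 0" using Suc.prems(5) us us1 by (auto simp: good_def)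
    obtain y where y: "y \<in> S" "\<psi> (y # v # v2 # vs2) \<noteq> 0" using Suc.prems(6) vs vs1 by (auto simp: good_def)
    have uS: "u \<in> S" "u2 \<in> S" "set us2 \<subseteq> S" "\<phi> (u # u2 # us2) \<noteq> 0"
      using Suc.prems(5) us us1 by (auto simp: good_def)
    have vS: "v \<in> S" "v2 \<in> S" "set vs2 \<subseteq> S" "\<phi> (v # v2 # vs2) \<noteq> 0"
      using Suc.prems(6) vs vs1 by (auto simp: good_def)
    have x': "\<psi> (u # x # u2 # us2) \<noteq> 0" and y': "\<psi> (v # y # v2 # vs2) \<noteq> 0"
      using x y alternating_hd_swap[OF \<psi>, of "u2 # us2" x u] alternating_hd_swap[OF \<psi>, of "v2 # vs2" y v]
        len2 Suc by auto
    have fn: "functional (\<lambda>w. \<phi> (u # w # us2))" "functional (\<lambda>w. \<phi> (v # w # vs2))"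
      "functional (\<lambda>w. \<psi> (u # w # u2 # us2))" "functional (\<lambda>w. \<psi> (v # w # v2 # vs2))"
      "functional (\<lambda>w. \<psi> (v # y # w # vs2))"
      using alternating_functional[OF \<phi>, of "[u]" us2] alternating_functional[OF \<phi>, of "[v]" vs2]
        alternating_functional[OF \<psi>, of "[u]" "u2 # us2"] alternating_functional[OF \<psi>, of "[v]" "v2 # vs2"]
        alternating_functional[OF \<psi>, of "[v, y]" vs2] len2 Suc by auto
    have rep: "\<psi> (v # v2 # v2 # vs2) = 0" "\<psi> (v # y # y # vs2) = 0"
      using alternating_repeat[OF \<psi>, of "[v]" vs2] len2 Suc by auto
    \<comment> \<open>The last alternative says in two ways that \<open>\<psi>\<close> contracted
      with \<open>v\<close> and \<open>w\<close> is nonzero. The two functionals are independent by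
      their values at \<open>y\<close> and \<open>v2\<close>, where the repeats in
      \<open>rep\<close> give the zeros.\<close>
    obtain w where w: "w \<in> S" "\<phi> (u # w # us2) \<noteq> 0" "\<phi> (v # w # vs2) \<noteq> 0" "\<psi> (u # w # u2 # us2) \<noteq> 0"
      "\<psi> (v # w # v2 # vs2) \<noteq> 0 \<or> \<psi> (v # y # w # vs2) \<noteq> 0"
      using functionals4_nonzero[OF S F fn(1) uS(2,4) fn(2) vS(2,4) fn(3) x(1) x' fn(4,5) y(1) vS(2) y' rep y'] by blast
    have "\<psi> (v # y # w # vs2) = - \<psi> (v # w # y # vs2)"
      using alternating_swap[OF \<psi>, of "[v]" vs2 y w] len2 Suc by simp
    then obtain y2 where y2: "y2 \<in> S" "\<psi> (v # w # y2 # vs2) \<noteq> 0" using w y vS by auto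
    have ex: "\<exists>T. good S (Suc r) \<phi> \<psi> (p # w # T)"
      if p: "p \<in> S" "length ps = r'" "set ps \<subseteq> S" "\<phi> (p # w # ps) \<noteq> 0" "q \<in> S" "\<psi> (p # w # q # ps) \<noteq> 0" for p q ps
    proof -
      have 1: "alternating r (\<lambda>xs. \<phi> (p # xs))" "alternating (Suc r) (\<lambda>xs. \<psi> (p # xs))"
        using \<phi> \<psi> by (auto intro: alternating_contract)
      then have 2: "alternating r' (\<lambda>xs. \<phi> (p # w # xs))" "alternating (Suc r') (\<lambda>xs. \<psi> (p # w # xs))"
        unfolding Suc by (auto dest: alternating_contract)
      obtain T where "good S r' (\<lambda>xs. \<phi> (p # w # xs)) (\<lambda>xs. \<psi> (p # w # xs)) T"
        using good_exists[OF S 2, of ps "q # ps"] p by auto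
      then have "good S r (\<lambda>xs. \<phi> (p # xs)) (\<lambda>xs. \<psi> (p # xs)) (w # T)"
        using good_contract[where u = w and \<phi> = "\<lambda>xs. \<phi> (p # xs)"] 1(2) w(1) unfolding Suc by blast
      then show ?thesis using good_contract[OF \<psi>] that(1) by blast
    qed
    obtain T1 where T1: "good S (Suc r) \<phi> \<psi> (u # w # T1)" using ex[of u us2 u2] uS w len2 by blast
    obtain T2 where T2: "good S (Suc r) \<phi> \<psi> (v # w # T2)" using ex[of v vs2 y2] vS w y2 len2 by blast
    have T1': "good S (Suc r) \<phi> \<psi> (w # u # T1)" and T2': "good S (Suc r) \<phi> \<psi> (w # v # T2)"
      using good_swap[OF \<phi> \<psi>, of S "[]"] T1 T2 by auto
    have "L us = L (u # w # T1)" unfolding us by (rule fixed_hd) (use Suc.prems(5) T1 us in simp_all)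
    also have "\<dots> = L (w # u # T1)" by (rule hd_swap) fact
    also have "\<dots> = L (w # v # T2)" by (rule fixed_hd) fact+
    also have "\<dots> = L (v # w # T2)" by (rule hd_swap) fact
    also have "\<dots> = L vs" unfolding vs by (rule fixed_hd) (use Suc.prems(6) T2 vs in simp_all)
    finally show ?thesis .
  qed
qed

subsection \<open>Constructing the form\<close>

text \<open>The coordinate along \<open>e\<close> in a basis of the whole space that contains
  \<open>e\<close> and a basis of the span of \<open>B\<close>.\<close>

lemma functional_separating:
  assumes "e \<notin> vec.span B"
  shows "\<exists>t :: 'a::field ^ 'n \<Rightarrow> 'a. functional t \<and> t e = 1 \<and> (\<forall>x\<in>vec.span B. t x = 0)"
proof -
  obtain B0 where B0: "B0 \<subseteq> vec.span B" "vec.independent B0" "vec.span B \<subseteq> vec.span B0"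
    using vec.maximal_independent_subset[of "vec.span B"] by blast
  have sp: "vec.span B0 = vec.span B"
    using B0 by (metis vec.span_mono vec.span_span subset_antisym)
  have ind: "vec.independent (insert e B0)" using B0(2) assms sp by (simp add: vec.independent_insert)
  define C where "C = vec.extend_basis (insert e B0)"
  have C: "insert e B0 \<subseteq> C" "vec.independent C" "vec.span C = UNIV"
    unfolding C_def using vec.extend_basis_superset[OF ind] vec.independent_extend_basis[OF ind]
      vec.span_extend_basis[OF ind] by auto
  define t where "t x = vec.representation C x e" for x
  have "functional t"
    unfolding functional_def t_def using C by (auto simp: vec.representation_add vec.representation_scale)
  moreover have "t e = 1" unfolding t_def using C by (simp add: vec.representation_basis)
  moreover have "t x = 0" if "x \<in> vec.span B" for x
  proof -
    have "t x = vec.representation B0 x e" unfolding t_def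
      using vec.representation_extend[OF C(2), of x B0] that sp C by auto
    moreover have "e \<notin> B0" using assms sp vec.span_base by blast
    ultimately show ?thesis using vec.representation_ne_zero by metis
  qed
  ultimately show ?thesis by blast
qed

text \<open>Induction on the generators. \<open>k\<close> and \<open>Z\<close> vary because the
  hypothesis is applied twice: to \<open>Z\<close> itself on the smaller span, and to its
  contraction with \<open>e\<close> in degree one less.\<close>

theorem alt_zero_set_form:
  fixes B :: "('a::field ^ 'n) set"
  assumes "finite B" "alt_zero_set k (vec.span B) Z"
  shows "\<exists>f. alternating k f \<and> (\<forall>xs. length xs = k \<and> set xs \<subseteq> vec.span B \<longrightarrow> (Z xs \<longleftrightarrow> f xs = 0))"
  using assms
proof (induction B arbitrary: k Z)
  case empty
  interpret alt_zero_set k "vec.span {}" Z by fact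
  show ?case
  proof (cases k)
    case 0
    then show ?thesis
      by (intro exI[of _ "\<lambda>_. if Z [] then 0 else 1"]) (auto simp: alternating_def)
  next
    case (Suc j)
    have "Z xs" if xs: "length xs = k" "set xs \<subseteq> vec.span {}" for xs
    proof -
      obtain us where us: "xs = 0 # us" using xs Suc by (cases xs) auto
      then have "0 \<in> {p \<in> vec.span {}. Z (p # us)}"
        using hd_subspace[of us] xs by (intro vec.subspace_0) auto
      then show ?thesis using us by simp
    qed
    then show ?thesis by (intro exI[of _ "\<lambda>_. 0"]) (auto simp: alternating_def)
  qed
next
  case (insert e B)
  show ?case
  proof (cases "e \<in> vec.span B \<or> k = 0")
    case True
    then show ?thesis
    proof
      assume "e \<in> vec.span B"
      then have "vec.span (insert e B) = vec.span B" by (rule vec.span_redundant)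
      then show ?thesis using insert by simp
    next
      assume "k = 0"
      then show ?thesis
        by (intro exI[of _ "\<lambda>_. if Z [] then 0 else 1"]) (auto simp: alternating_def)
    qed
  next
    case False
    then obtain r where k: "k = Suc r" and e: "e \<notin> vec.span B" by (cases k) auto
    let ?S = "vec.span B" and ?T = "vec.span (insert e B)"
    have sub: "?S \<subseteq> ?T" by (intro vec.span_mono) auto
    have S: "vec.subspace ?S" by simp
    have eT: "e \<in> ?T" by (simp add: vec.span_base)
    interpret alt_zero_set k ?T Z by fact
    obtain g where g: "alternating (Suc r) g"
      and g_iff: "\<And>xs. length xs = Suc r \<Longrightarrow> set xs \<subseteq> ?S \<Longrightarrow> Z xs \<longleftrightarrow> g xs = 0"
      using insert.IH[OF restrict[OF S sub]] k by blast
    obtain g' where g': "alternating r g'"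
      and g'_iff: "\<And>xs. length xs = r \<Longrightarrow> set xs \<subseteq> ?S \<Longrightarrow> Z (e # xs) \<longleftrightarrow> g' xs = 0"
      using insert.IH[OF contract[OF k eT S sub]] by blast
    let ?good = "good ?S r g' g"
    have lc: "Z ((a *s x + b *s y) # us)"
      if "length us = r" "set us \<subseteq> ?S" "x \<in> ?T" "y \<in> ?T" "Z (x # us)" "Z (y # us)" for a b x y us
      using that sub k by (intro hd_lincomb) auto
    have sc: "Z ((c *s x) # us) \<longleftrightarrow> Z (x # us)"
      if "length us = r" "set us \<subseteq> ?S" "x \<in> ?T" "c \<noteq> 0" for c x us
      using that sub k by (intro hd_scale_iff) auto
    have inT: "a *s x + b *s e \<in> ?T" if "x \<in> ?S" for a b x
      using that sub eT by (auto intro!: vec.span_add vec.span_scale)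

    \<comment> \<open>The sought form takes the value \<open>a * g (x # us) + b * l * g' us\<close>
      when the head is \<open>a *s x + b *s e\<close>. So \<open>R us l\<close> says that the heads
      on which this form visibly vanishes are admissible.\<close>
    define R where "R us l \<longleftrightarrow> (\<forall>x\<in>?S. Z (((l * g' us) *s x - g (x # us) *s e) # us))" for us l
    \<comment> \<open>One test vector suffices: every other \<open>x\<close> differs from a multiple
      of \<open>x0\<close> by a vector on which \<open>g\<close> vanishes, and that vector is itself
      admissible.\<close>
    have RI: "R us l" if us: "?good us" and x0: "x0 \<in> ?S" "g (x0 # us) \<noteq> 0"
      and Z0: "Z (((l * g' us) *s x0 - g (x0 # us) *s e) # us)" for us l x0
      unfolding R_def
    proof
      fix x assume x: "x \<in> ?S"
      have us': "length us = r" "set us \<subseteq> ?S" using us by (auto simp: good_def)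
      define c where "c = g (x # us) / g (x0 # us)"
      have xS: "1 *s x + (- c) *s x0 \<in> ?S" using x x0 by (intro vec.span_add vec.span_scale)
      have "g ((1 *s x + (- c) *s x0) # us) = 0"
        using alternating_hd_lincomb[OF g us'(1), of 1 x "- c" x0] x0 by (simp add: c_def)
      then have Z1: "Z ((1 *s x + (- c) *s x0) # us)" using g_iff xS us' by simp
      have T0: "(l * g' us) *s x0 - g (x0 # us) *s e \<in> ?T"
        using inT[OF x0(1), of "l * g' us" "- g (x0 # us)"] by (simp add: vec.scale_minus_left)
      have "Z ((c *s ((l * g' us) *s x0 - g (x0 # us) *s e) + (l * g' us) *s (1 *s x + (- c) *s x0)) # us)"
        by (rule lc) (use us' T0 xS sub Z0 Z1 in auto)
      moreover have "c *s ((l * g' us) *s x0 - g (x0 # us) *s e) + (l * g' us) *s (1 *s x + (- c) *s x0)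
          = (l * g' us) *s x - g (x # us) *s e"
        using x0 by (simp add: c_def vec_eq_iff field_simps)
      ultimately show "Z (((l * g' us) *s x - g (x # us) *s e) # us)" by (simp only:)
    qed
    have R_exists: "\<exists>l. l \<noteq> 0 \<and> R us l" if us: "?good us" for us
    proof -
      have us': "length us = r" "set us \<subseteq> ?S" "g' us \<noteq> 0" using us by (auto simp: good_def)
      obtain x0 where x0: "x0 \<in> ?S" "g (x0 # us) \<noteq> 0" using us by (auto simp: good_def)
      \<comment> \<open>Neither \<open>x0\<close> nor \<open>e\<close> is admissible, so both
        coefficients of this admissible combination are nonzero and \<open>l\<close> is the solution
        of \<open>a * g (x0 # us) + b * l * g' us = 0\<close>.\<close>
      obtain a b where ab: "a \<noteq> 0 \<or> b \<noteq> 0" "Z ((a *s x0 + b *s e) # us)"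
        using hd_codim[of us x0 e] us' k x0 sub eT by blast
      have nZ: "\<not> Z (x0 # us)" "\<not> Z (e # us)" using g_iff[of "x0 # us"] g'_iff[of us] x0 us' by auto
      have a: "a \<noteq> 0" using ab nZ sc[of us e b] us' eT by auto
      have b: "b \<noteq> 0" using ab nZ sc[of us x0 a] us' x0 sub by auto
      define l where "l = - (a * g (x0 # us)) / (b * g' us)"
      have eq: "(- (g (x0 # us) / b)) *s (a *s x0 + b *s e) = (l * g' us) *s x0 - g (x0 # us) *s e"
        using b us'(3) by (simp add: l_def vec_eq_iff field_simps)
      have "Z (((- (g (x0 # us) / b)) *s (a *s x0 + b *s e)) # us)"
        using sc[of us "a *s x0 + b *s e" "- (g (x0 # us) / b)"] ab us' x0 b inT by simp
      then have "R us l" unfolding eq by (rule RI[OF us x0])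
      moreover have "l \<noteq> 0" using a b x0 us' by (simp add: l_def)
      ultimately show ?thesis by blast
    qed
    have R_unique: "l1 = l2" if us: "?good us" and R: "R us l1" "R us l2" for us l1 l2
    proof (rule ccontr)
      \<comment> \<open>The difference of the two admissible heads would be a nonzero multiple of
        \<open>x0\<close>, which is not admissible.\<close>
      assume "l1 \<noteq> l2"
      have us': "length us = r" "set us \<subseteq> ?S" "g' us \<noteq> 0" using us by (auto simp: good_def)
      obtain x0 where x0: "x0 \<in> ?S" "g (x0 # us) \<noteq> 0" using us by (auto simp: good_def)
      have T0: "(l * g' us) *s x0 - g (x0 # us) *s e \<in> ?T" for l
        using inT[OF x0(1), of "l * g' us" "- g (x0 # us)"] by (simp add: vec.scale_minus_left)
      have "Z ((1 *s ((l1 * g' us) *s x0 - g (x0 # us) *s e)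
          + (- 1) *s ((l2 * g' us) *s x0 - g (x0 # us) *s e)) # us)"
        by (rule lc) (use R x0 us' T0 R_def in auto)
      moreover have "1 *s ((l1 * g' us) *s x0 - g (x0 # us) *s e)
          + (- 1) *s ((l2 * g' us) *s x0 - g (x0 # us) *s e) = ((l1 - l2) * g' us) *s x0"
        by (simp add: vec_eq_iff algebra_simps)
      ultimately have "Z (x0 # us)" using sc[of us x0 "(l1 - l2) * g' us"] us' x0 sub \<open>l1 \<noteq> l2\<close> by auto
      then show False using g_iff[of "x0 # us"] x0 us' by auto
    qed
    have R_swap: "R (as @ y # x # bs) l"
      if gd: "?good (as @ x # y # bs)" and R: "R (as @ x # y # bs) l" for as x y bs l
      unfolding R_def
    proof
      fix z assume z: "z \<in> ?S"
      let ?v = "\<lambda>us. (l * g' us) *s z - g (z # us) *s e"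
      have len: "length as + length bs + 2 = r" "set (as @ x # y # bs) \<subseteq> ?S" using gd by (auto simp: good_def)
      have vT: "?v us \<in> ?T" for us
        using inT[OF z, of "l * g' us" "- g (z # us)"] by (simp add: vec.scale_minus_left)
      have "g' (as @ y # x # bs) = - g' (as @ x # y # bs)"
        using alternating_swap[OF g' len(1), of y x] .
      moreover have "g (z # as @ y # x # bs) = - g (z # as @ x # y # bs)"
        using alternating_swap[OF g, of "z # as" bs y x] len by simp
      ultimately have v: "?v (as @ y # x # bs) = (- 1) *s ?v (as @ x # y # bs)"
        by (simp add: vec_eq_iff algebra_simps)
      have "Z (?v (as @ x # y # bs) # as @ x # y # bs)" using R z unfolding R_def by blast
      then have "Z (?v (as @ y # x # bs) # as @ x # y # bs)"
        unfolding v using sc[of "as @ x # y # bs" "?v (as @ x # y # bs)" "- 1"] len vT by simp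
      then show "Z (?v (as @ y # x # bs) # as @ y # x # bs)"
        using swap[of "?v (as @ y # x # bs) # as" bs x y] len sub vT k by auto
    qed
    \<comment> \<open>The two lines \<open>\<langle>l a v - \<gamma> e, u\<rangle>\<close> and \<open>\<langle>e, b u - a v\<rangle>\<close> of the complex (modulo \<open>T\<close>) meet in
      \<open>P = l a v - l b u - \<gamma> e\<close>, so all lines through \<open>P\<close> in \<open>\<langle>u, v, e\<rangle>\<close> belong to it.\<close>
    have R_exchange: "R (v # T) l"
      if gu: "?good (u # T)" and gv: "?good (v # T)" and R: "R (u # T) l" and uv: "g (u # v # T) \<noteq> 0"
      for u v T l
    proof (rule RI[OF gv _ uv])
      have T: "Suc (length T) = r" "set T \<subseteq> ?S" and uS: "u \<in> ?S" and vS: "v \<in> ?S"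
        using gu gv by (auto simp: good_def)
      show "u \<in> ?S" by fact
      define a b \<gamma> where "a = g' (u # T)" and "b = g' (v # T)" and "\<gamma> = g (v # u # T)"
      have \<gamma>: "g (u # v # T) = - \<gamma>"
        using alternating_swap[OF g, of "[]" T u v] T by (simp add: \<gamma>_def)
      define P where "P = (l * a) *s v - (l * b) *s u - \<gamma> *s e"
      have TT: "set T \<subseteq> ?T" "u \<in> ?T" "v \<in> ?T" using T uS vS sub by auto
      have PT: "P \<in> ?T" unfolding P_def using TT eT by (intro vec.span_diff vec.span_scale)
      have sh: "Z ((x + c *s y) # y # T) \<longleftrightarrow> Z (x # y # T)" if "x \<in> ?T" "y \<in> ?T" for x y c
        using that T TT k by (intro hd_shift_iff repeat) auto
      have sw: "Z (x # y # T) \<longleftrightarrow> Z (y # x # T)" if "x \<in> ?T" "y \<in> ?T" for x y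
        using swap[of "[]" T x y] that T TT k by auto
      have "Z (((l * a) *s v - \<gamma> *s e) # u # T)"
        using R vS unfolding R_def a_def \<gamma>_def by blast
      then have "Z (((l * a) *s v - \<gamma> *s e + (- (l * b)) *s u) # u # T)"
        using TT eT by (subst sh) (auto intro: vec.span_diff vec.span_scale)
      moreover have "(l * a) *s v - \<gamma> *s e + (- (l * b)) *s u = P"
        by (simp add: P_def vec_eq_iff)
      ultimately have Pu: "Z (u # P # T)" using sw[OF PT TT(2)] by (simp only:)
      \<comment> \<open>This combination is killed by \<open>g'\<close>, so together with
        \<open>e\<close> and \<open>T\<close> it gives an admissible list; combined with
        \<open>e\<close> itself it yields \<open>P\<close>.\<close>
      have baS: "b *s u + (- a) *s v \<in> ?S" using uS vS by (intro vec.span_add vec.span_scale)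
      have "r = Suc (length T)" using T by simp
      then have "g' ((b *s u + (- a) *s v) # T) = 0"
        using alternating_hd_lincomb[of "length T" g' T b u "- a" v] g' by (simp add: a_def b_def)
      then have "Z (e # (b *s u + (- a) *s v) # T)" using g'_iff T baS by simp
      then have Zeb: "Z ((b *s u + (- a) *s v) # e # T)" using sw[OF eT, of "b *s u + (- a) *s v"] baS sub by blast
      have "Z (((- l) *s (b *s u + (- a) *s v) + (- \<gamma>) *s e) # e # T)"
        by (rule hd_lincomb[OF _ _ _ _ Zeb]) (use T TT eT k baS sub repeat[of T e] in auto)
      moreover have "(- l) *s (b *s u + (- a) *s v) + (- \<gamma>) *s e = P"
        by (simp add: P_def vec_eq_iff algebra_simps)
      ultimately have Pe: "Z (e # P # T)" using sw[OF PT eT] by (simp only:)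
      \<comment> \<open>\<open>P\<close>, \<open>u\<close> and \<open>e\<close> are all admissible
        in front of \<open>P # T\<close>, hence so is their combination \<open>(l * a) *s v\<close>,
        and \<open>l * a\<close> is nonzero.\<close>
      have "Z (P # P # T)" using T TT PT k by (intro repeat) auto
      then have Pu': "Z ((1 *s P + (l * b) *s u) # P # T)"
        using Pu PT TT T k by (intro hd_lincomb) auto
      have "Z ((1 *s (1 *s P + (l * b) *s u) + \<gamma> *s e) # P # T)"
        by (rule hd_lincomb[OF _ _ _ _ Pu' Pe]) (use PT TT eT T k in \<open>auto intro: vec.span_add vec.span_scale\<close>)
      moreover have "1 *s (1 *s P + (l * b) *s u) + \<gamma> *s e = (l * a) *s v"
        by (simp add: P_def vec_eq_iff)
      ultimately have Pv: "Z (((l * a) *s v) # P # T)" by (simp only:)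
      have "l \<noteq> 0" using R_exists[OF gu] R_unique[OF gu R] by blast
      moreover have "a \<noteq> 0" using gu by (simp add: good_def a_def)
      ultimately have "Z (v # P # T)" using Pv hd_scale_iff[of "P # T" v "l * a"] T TT PT k by auto
      then have "Z (P # v # T)" using sw[OF PT TT(3)] by blast
      then have "Z ((P + (- (l * a)) *s v) # v # T)" using sh[OF PT TT(3)] by blast
      then have "Z (((- 1) *s (P + (- (l * a)) *s v)) # v # T)"
        using T TT PT k by (subst hd_scale_iff) (auto intro: vec.span_diff vec.span_scale)
      moreover have "(- 1) *s (P + (- (l * a)) *s v) = (l * g' (v # T)) *s u - g (u # v # T) *s e"
        by (simp add: P_def \<gamma> b_def vec_eq_iff algebra_simps)
      ultimately show "Z (((l * g' (v # T)) *s u - g (u # v # T) *s e) # v # T)" by (simp only:)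
    qed

    define L where "L us = (THE l. R us l)" for us
    have L: "L us = l" if "?good us" "R us l" for us l
      unfolding L_def using that R_unique by blast
    have RL: "R us (L us)" and L0: "L us \<noteq> 0" if "?good us" for us
      using R_exists[OF that] L[OF that] by auto
    have L_exchange1: "L (u # T) = L (v # T)"
      if "?good (u # T)" "?good (v # T)" "g (u # v # T) \<noteq> 0" for u v T
      using R_exchange[OF that(1,2) RL[OF that(1)] that(3)] L[OF that(2)] by simp
    have L_exchange: "L (u # T) = L (v # T)" if gu: "?good (u # T)" and gv: "?good (v # T)" for u v T
    proof (cases "g (u # v # T) = 0")
      case True
      have T: "Suc (length T) = r" "set T \<subseteq> ?S" and uS: "u \<in> ?S" and vS: "v \<in> ?S" and gu0: "g' (u # T) \<noteq> 0"
        using gu gv by (auto simp: good_def)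
      obtain x y where x: "x \<in> ?S" "g (x # u # T) \<noteq> 0" and y: "y \<in> ?S" "g (y # v # T) \<noteq> 0"
        using gu gv by (auto simp: good_def)
      have fn: "functional (\<lambda>w. g (w # u # T))" "functional (\<lambda>w. g (w # v # T))" "functional (\<lambda>w. g' (w # T))"
        using alternating_functional[OF g, of "[]" "u # T"] alternating_functional[OF g, of "[]" "v # T"]
          alternating_functional[OF g', of "[]" T] T by auto
      obtain c where c: "c \<in> ?S" "g (c # u # T) \<noteq> 0" "g (c # v # T) \<noteq> 0"
        using functionals2_nonzero[OF S fn(1) x fn(2) y] by blast
      have uu: "g (u # u # T) = 0" using alternating_repeat[OF g, of "[]" T] T by simp
      \<comment> \<open>An intermediate head \<open>d\<close> connects \<open>u\<close> to
        \<open>v\<close>. If \<open>c\<close> fails only at \<open>g'\<close>, adding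
        \<open>u\<close> repairs this without changing the values of \<open>g\<close>, since
        \<open>g\<close> vanishes at \<open>u # u # T\<close> and at
        \<open>u # v # T\<close>.\<close>
      obtain d where d: "d \<in> ?S" "g (d # u # T) \<noteq> 0" "g (d # v # T) \<noteq> 0" "g' (d # T) \<noteq> 0"
      proof (cases "g' (c # T) = 0")
        case c0: True
        have "g ((c + u) # u # T) = g (c # u # T)" "g ((c + u) # v # T) = g (c # v # T)"
          "g' ((c + u) # T) = g' (u # T)"
          using functional_add[OF fn(1), of c u] functional_add[OF fn(2), of c u]
            functional_add[OF fn(3), of c u] uu True c0 by simp_all
        then show thesis using that[of "c + u"] c gu0 uS by (simp add: vec.span_add)
      qed (use that c in blast)
      have ud: "g (u # d # T) \<noteq> 0" using alternating_swap[OF g, of "[]" T u d] T d by simp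
      have gd: "?good (d # T)" using T d uS ud by (auto simp: good_def)
      have "L (u # T) = L (d # T)" by (rule L_exchange1[OF gu gd ud])
      also have "\<dots> = L (v # T)" by (rule L_exchange1[OF gd gv d(3)])
      finally show ?thesis .
    qed (use L_exchange1 gu gv in blast)
    have L_swap: "L (as @ x # y # bs) = L (as @ y # x # bs)" if gd: "?good (as @ x # y # bs)" for as x y bs
      using L[OF good_swap[OF g' g gd] R_swap[OF gd RL[OF gd]]] by simp
    have L_const: "L us = L vs" if gd: "?good us" "?good vs" for us vs
    proof (cases "\<exists>c :: 'a. c \<noteq> 0 \<and> c \<noteq> 1")
      case True
      then obtain c :: 'a where "c \<noteq> 0" "c \<noteq> 1" by blast
      from good_connected[OF S this g' g, of L] L_swap L_exchange gd show ?thesis by blast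
    next
      case False
      then show ?thesis using L0 gd by metis
    qed
    obtain l where l: "l \<noteq> 0" "\<And>us. ?good us \<Longrightarrow> R us l"
    proof (cases "\<exists>us. ?good us")
      case True
      then obtain us where us: "?good us" by blast
      show thesis using that[of "L us"] L0[OF us] RL L_const[OF us] by metis
    next
      \<comment> \<open>With no good lists there is no condition on \<open>l\<close>. It must only
        be nonzero, because \<open>l * g' us\<close> is the whole value of the form at heads
        \<open>x + e\<close> with \<open>g (x # us) = 0\<close>.\<close>
      case False
      then show thesis using that[of 1] by simp
    qed

    \<comment> \<open>\<open>t\<close> plays the dual vector of \<open>e\<close>, and
      \<open>s\<close> below is the projection along \<open>e\<close>, identical on the span of
      \<open>B\<close>; pulling back along \<open>s\<close> extends \<open>g\<close> and
      \<open>g'\<close> beyond that span.\<close>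
    obtain t where t: "functional t" "t e = 1" "\<And>x. x \<in> ?S \<Longrightarrow> t x = 0"
      using functional_separating[OF e] by blast
    define s where "s x = x - t x *s e" for x
    have s_lin: "s (a *s x + b *s y) = a *s s x + b *s s y" for a b x y
      using t(1) by (simp add: s_def functional_lincomb vec_eq_iff algebra_simps)
    have s_S: "map s xs = xs" if "set xs \<subseteq> ?S" for xs
      using that t(3) by (intro map_idI) (auto simp: s_def)
    define f where "f xs = g (map s xs) + l * wedge t (\<lambda>ys. g' (map s ys)) xs" for xs
    have f: "alternating k f"
      unfolding f_def k using t(1)
      by (intro alternating_lin alternating_map[OF g] alternating_wedge alternating_map[OF g'] s_lin)
        (simp_all add: functional_lincomb)
    have wS: "wedge t h xs = 0" if "set xs \<subseteq> ?S" for h xs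
      using that t(3) by (intro wedge_kernel) auto
    have base: "Z xs \<longleftrightarrow> f xs = 0" if "length xs = k" "set xs \<subseteq> ?S" for xs
      using g_iff that k by (simp add: f_def s_S wS)
    have step: "Z ((x + e) # us) \<longleftrightarrow> f ((x + e) # us) = 0"
      if us: "Suc (length us) = k" "set us \<subseteq> ?S" and x: "x \<in> ?S" for x us
    proof -
      have lus: "length us = r" using us k by simp
      have xT: "x \<in> ?T" using x sub by blast
      have "t (x + e) = 1" using functional_add[OF t(1), of x e] t x by simp
      \<comment> \<open>Only the first term of the wedge survives, as \<open>t\<close> vanishes on
        all of \<open>us\<close>.\<close>
      then have fx: "f ((x + e) # us) = g (x # us) + l * g' us"
        using us by (simp add: f_def s_S wS s_def)
      have Zx: "Z (x # us) \<longleftrightarrow> g (x # us) = 0" using g_iff[of "x # us"] x us lus by simp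
      have Ze: "Z (e # us) \<longleftrightarrow> g' us = 0" using g'_iff us lus by simp
      show ?thesis
      proof (cases "g' us = 0")
        case True
        then have "Z ((x + 1 *s e) # us) \<longleftrightarrow> Z (x # us)"
          using Ze us sub xT eT by (intro hd_shift_iff) auto
        then show ?thesis using True fx Zx by simp
      next
        case g'0: False
        show ?thesis
        proof (cases "g (x # us) = 0")
          case True
          then have "Z ((e + 1 *s x) # us) \<longleftrightarrow> Z (e # us)"
            using Zx us sub xT eT by (intro hd_shift_iff) auto
          then show ?thesis using True g'0 l fx Ze by (simp add: add.commute)
        next
          case g0: False
          have gd: "?good us" using g0 g'0 x us lus by (auto simp: good_def)
          let ?v = "(l * g' us) *s x - g (x # us) *s e"
          have Zv: "Z (?v # us)" using l(2)[OF gd] x unfolding R_def by blast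
          have vT: "?v \<in> ?T" using xT eT by (intro vec.span_diff vec.span_scale)
          have xeT: "x + e \<in> ?T" using xT eT by (rule vec.span_add)
          show ?thesis
          proof
            assume "Z ((x + e) # us)"
            \<comment> \<open>The \<open>e\<close>-parts cancel and leave \<open>x\<close> with the
              coefficient \<open>f ((x + e) # us)\<close>; since \<open>x\<close> is not admissible,
              that coefficient is zero.\<close>
            then have "Z ((1 *s ?v + g (x # us) *s (x + e)) # us)"
              by (intro lc[OF lus us(2) vT xeT Zv])
            moreover have "1 *s ?v + g (x # us) *s (x + e) = (g (x # us) + l * g' us) *s x"
              by (simp add: vec_eq_iff algebra_simps)
            ultimately have "Z (((g (x # us) + l * g' us) *s x) # us)" by (simp only:)
            then show "f ((x + e) # us) = 0"
              using sc[OF lus us(2) xT, of "g (x # us) + l * g' us"] Zx g0 fx by argo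
          next
            assume "f ((x + e) # us) = 0"
            then have "l * g' us = - g (x # us)" using fx by (simp add: eq_neg_iff_add_eq_0 add.commute)
            then have "?v = (- g (x # us)) *s (x + e)" by (simp add: vec_eq_iff algebra_simps)
            then show "Z ((x + e) # us)" using Zv sc[OF lus us(2) xeT, of "- g (x # us)"] g0 by simp
          qed
        qed
      qed
    qed
    have "Z xs \<longleftrightarrow> f xs = 0" if "length xs = k" "set xs \<subseteq> ?T" for xs
      using insert.prems alt_zero_set_alternating[OF f vec.subspace_span] base step[OF _ _ _] that
      by (rule alt_zero_set_agree)
    then show ?thesis using f by blast
  qed
qed

subsection \<open>Subspaces and pencils\<close>

lemma psub_iff_vsub: "psub d X \<longleftrightarrow> vsub (Suc d) X"
  by (simp add: psub_def vsub_def)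

lemma vsub_subspace: "vsub k U \<Longrightarrow> vec.subspace U"
  by (simp add: vsub_def)

lemma vsub_eqI: "vsub k A \<Longrightarrow> vsub k B \<Longrightarrow> A \<subseteq> B \<Longrightarrow> A = B"
  by (metis vsub_def vec.subspace_dim_equal order_refl)

lemma vsub_not_subset: "vsub k U \<Longrightarrow> vsub (Suc k) V \<Longrightarrow> \<exists>a. a \<in> V \<and> a \<notin> U"
  using vec.dim_subset[of V U] by (auto simp: vsub_def)

lemma vsub_insert:
  assumes "vsub k U" "a \<notin> U"
  shows "vsub (Suc k) (vec.span (insert a U))"
proof -
  have "a \<notin> vec.span U" using assms by (metis vec.span_eq_iff vsub_def)
  then show ?thesis using assms by (simp add: vsub_def vec.dim_insert)
qed

lemma vsub_insert_eq:
  assumes "vsub k U" "vsub (Suc k) V" "U \<subseteq> V" "a \<in> V" "a \<notin> U"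
  shows "vec.span (insert a U) = V"
  using assms by (intro vsub_eqI[OF vsub_insert[OF assms(1,5)] assms(2)] vec.span_minimal)
    (auto simp: vsub_def)

lemma vsub_inter:
  assumes U: "vsub k U" and V: "vsub (Suc k) V1" "vsub (Suc k) V2" "U \<subseteq> V1" "U \<subseteq> V2" "V1 \<noteq> V2"
  shows "V1 \<inter> V2 = U"
proof (rule ccontr)
  assume "V1 \<inter> V2 \<noteq> U"
  then obtain a where "a \<in> V1" "a \<in> V2" "a \<notin> U" using V by blast
  then show False using vsub_insert_eq[OF U] V by metis
qed

lemma points_span_line:
  assumes M: "vsub 2 M" and P: "psub 0 P" "psub 0 Q" "P \<noteq> Q" "P \<subseteq> M" "Q \<subseteq> M"
    and Y: "vec.subspace Y" "P \<subseteq> Y" "Q \<subseteq> Y"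
  shows "M \<subseteq> Y"
proof -
  have "\<not> Q \<subseteq> P" using P vsub_eqI[of 1 Q P] by (auto simp: psub_iff_vsub)
  then obtain q where q: "q \<in> Q" "q \<notin> P" by blast
  have "vec.span (insert q P) = M"
    using P M q by (intro vsub_insert_eq[of 1]) (auto simp: psub_iff_vsub numeral_2_eq_2)
  moreover have "vec.span (insert q P) \<subseteq> Y" using q Y by (intro vec.span_minimal) auto
  ultimately show ?thesis by simp
qed

lemma point_span:
  assumes "psub 0 P" "p \<in> P" "p \<noteq> 0"
  shows "P = vec.span {p}"
proof -
  have "vsub 1 (vec.span {p})"
    using assms(3) vsub_insert[of 0 "{0}" p] by (simp add: vsub_def vec.dim_insert)
  moreover have "vec.span {p} \<subseteq> P" using assms by (intro vec.span_minimal) (auto simp: psub_def)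
  ultimately show ?thesis using vsub_eqI[of 1 "vec.span {p}" P] assms by (simp add: psub_iff_vsub)
qed

lemma psub_0_span: "p \<noteq> 0 \<Longrightarrow> psub 0 (vec.span {p})"
  by (simp add: psub_def vec.dim_insert)

lemma point_nonzero:
  assumes "psub 0 P"
  obtains p where "p \<in> P" "p \<noteq> 0" "P = vec.span {p}"
proof -
  have "vsub 0 {0}" by (simp add: vsub_def)
  then obtain p where "p \<in> P" "p \<noteq> 0"
    using vsub_not_subset[of 0 "{0}" P] assms by (auto simp: psub_iff_vsub)
  then show ?thesis using that point_span[OF assms] by blast
qed

text \<open>Take one vector of \<open>V1\<close> and one of \<open>V2\<close>, both outside
  \<open>U\<close>: their sum lies in neither subspace because \<open>V1\<close> and
  \<open>V2\<close> meet only in \<open>U\<close>.\<close>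

lemma pencil_third:
  assumes U: "vsub k U" and V: "psub k V1" "psub k V2" "U \<subseteq> V1" "U \<subseteq> V2" "V1 \<noteq> V2"
    and W: "vec.subspace W" "V1 \<subseteq> W" "V2 \<subseteq> W"
  shows "\<exists>V3. psub k V3 \<and> U \<subseteq> V3 \<and> V3 \<subseteq> W \<and> V3 \<noteq> V1 \<and> V3 \<noteq> V2"
proof -
  have V': "vsub (Suc k) V1" "vsub (Suc k) V2" using V by (auto simp: psub_iff_vsub)
  have int: "V1 \<inter> V2 = U" using vsub_inter[OF U V' V(3-5)] .
  obtain a b where a: "a \<in> V1" "a \<notin> U" and b: "b \<in> V2" "b \<notin> U"
    using vsub_not_subset[OF U V'(1)] vsub_not_subset[OF U V'(2)] by blast
  have "a + b \<notin> V1"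
    using a b int vec.subspace_diff[OF vsub_subspace[OF V'(1)], of "a + b" a] by auto
  moreover have "a + b \<notin> V2"
    using a b int vec.subspace_diff[OF vsub_subspace[OF V'(2)], of "a + b" b] by auto
  moreover have "a + b \<in> vec.span (insert (a + b) U)" "U \<subseteq> vec.span (insert (a + b) U)"
    by (auto intro: vec.span_base)
  moreover have "vec.span (insert (a + b) U) \<subseteq> W"
    using W a b V(3) by (intro vec.span_minimal) (auto intro: vec.subspace_add)
  moreover have "psub k (vec.span (insert (a + b) U))"
    using vsub_insert[OF U, of "a + b"] calculation(1) V(3) by (auto simp: psub_iff_vsub)
  ultimately show ?thesis by metis
qed

lemma pencil_hull:
  assumes U: "vsub k U" and V: "psub k V1" "psub k V2" "U \<subseteq> V1" "U \<subseteq> V2" "V1 \<noteq> V2"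
  shows "\<exists>W. vsub (k + 2) W \<and> V1 \<subseteq> W \<and> V2 \<subseteq> W"
proof -
  have V': "vsub (Suc k) V1" "vsub (Suc k) V2" using V by (auto simp: psub_iff_vsub)
  obtain b where b: "b \<in> V2" "b \<notin> V1"
    using V(5) vsub_eqI[OF V'(2,1)] by blast
  have "vec.span (insert b U) = V2" using vsub_insert_eq[OF U V'(2) V(4) b(1)] b V by blast
  moreover have "vec.span (insert b U) \<subseteq> vec.span (insert b V1)" using V by (intro vec.span_mono) auto
  moreover have "V1 \<subseteq> vec.span (insert b V1)" by (auto intro: vec.span_base)
  moreover have "vsub (k + 2) (vec.span (insert b V1))" using vsub_insert[OF V'(1) b(2)] by simp
  ultimately show ?thesis by blast
qed

section \<open>From a linear mapping to a geometric hyperplane of the Grassmannian\<close>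

text \<open>A single member of the pencil with vertex \<open>U\<close> decides for all members
  whether images fall into \<open>U\<close>. A third member \<open>V2\<close> on the line through
  \<open>V0\<close> and \<open>V1\<close> excludes the mixed situation, because \<open>V1\<close>
  and \<open>V2\<close> meet only in \<open>U\<close>.\<close>

lemma linear_mapping_pencil:
  assumes lin: "linear_mapping_pts k chi" and inc: "\<forall>V \<in> pdom k chi. the (chi V) \<subseteq> V"
    and U: "vsub k U" and V: "psub k V0" "psub k V1" "U \<subseteq> V0" "U \<subseteq> V1"
    and V0: "chi V0 = None \<or> the (chi V0) \<subseteq> U" and V1: "chi V1 = Some P1"
  shows "P1 \<subseteq> U"
proof (rule ccontr)
  assume nP: "\<not> P1 \<subseteq> U"
  then have "V0 \<noteq> V1" using V0 V1 by auto
  have V': "vsub (Suc k) V0" "vsub (Suc k) V1" using V by (auto simp: psub_iff_vsub)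
  obtain W where W: "vsub (k + 2) W" "V0 \<subseteq> W" "V1 \<subseteq> W"
    using pencil_hull[OF U V \<open>V0 \<noteq> V1\<close>] by blast
  obtain V2 where V2: "psub k V2" "U \<subseteq> V2" "V2 \<subseteq> W" "V2 \<noteq> V0" "V2 \<noteq> V1"
    using pencil_third[OF U V \<open>V0 \<noteq> V1\<close> vsub_subspace[OF W(1)] W(2,3)] by blast
  have int: "V1 \<inter> V2 = U" using vsub_inter[OF U V'(2) _ V(4) V2(2)] V2 by (auto simp: psub_iff_vsub)
  define L where "L = {X. psub k X \<and> U \<subseteq> X \<and> X \<subseteq> W}"
  have L: "V0 \<in> L" "V1 \<in> L" "V2 \<in> L" using V V2 W by (auto simp: L_def)
  have gl: "grass_line k L" unfolding grass_line_def L_def using U W V by blast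
  have pt: "psub 0 (the (chi X))" if "X \<in> pdom k chi" for X
    using lin that by (simp add: linear_mapping_pts_def)
  have dom1: "V1 \<in> pdom k chi" using V V1 by (simp add: pdom_def)
  have P1: "P1 \<subseteq> V1" "psub 0 P1" using inc[rule_format, OF dom1] V1 pt[OF dom1] by auto
  have "(grass_line 0 (pimage chi L) \<and> L \<subseteq> pdom k chi \<and> bij_betw (\<lambda>X. the (chi X)) L (pimage chi L))
      \<or> (card (pimage chi L) = 1 \<and> card (L \<inter> pexc k chi) = 1) \<or> L \<subseteq> pexc k chi"
    using lin gl unfolding linear_mapping_pts_def Let_def by blast
  then show False
  proof (elim disjE conjE)
    assume "L \<subseteq> pexc k chi"
    then show False using L V1 by (auto simp: pexc_def)
  next
    assume c: "card (pimage chi L) = 1" "card (L \<inter> pexc k chi) = 1"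
    have "P1 \<in> pimage chi L" using L V1 by (force simp: pimage_def)
    then have im: "pimage chi L = {P1}" using c(1) by (metis card_1_singletonE singletonD)
    have all: "the (chi X) = P1" if "X \<in> L" "chi X \<noteq> None" for X
      using im that by (auto simp: pimage_def)
    \<comment> \<open>\<open>V0\<close> is thus the only exceptional member, so \<open>V2\<close>
      has image \<open>P1\<close> and puts it into both \<open>V1\<close> and \<open>V2\<close>,
      that is, into \<open>U\<close>.\<close>
    have "chi V0 = None" using V0 all[OF L(1)] nP by auto
    then have "V0 \<in> L \<inter> pexc k chi" using L V by (auto simp: pexc_def)
    then have "L \<inter> pexc k chi = {V0}" using c(2) by (metis card_1_singletonE singletonD)
    then have "chi V2 \<noteq> None" using L V2 by (auto simp: pexc_def)
    then have "the (chi V2) = P1" "the (chi V2) \<subseteq> V2" using all[OF L(3)] inc V2 by (auto simp: pdom_def)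
    then show False using int P1 nP by blast
  next
    assume c: "grass_line 0 (pimage chi L)" "L \<subseteq> pdom k chi" "bij_betw (\<lambda>X. the (chi X)) L (pimage chi L)"
    define P0 P2 where "P0 = the (chi V0)" and "P2 = the (chi V2)"
    obtain M where M: "vsub 2 M" "\<And>X. X \<in> pimage chi L \<Longrightarrow> X \<subseteq> M"
      using c(1) unfolding grass_line_def by (auto simp: numeral_2_eq_2)
    have im: "the (chi X) \<in> pimage chi L" if "X \<in> L" for X
      using that c(3) by (auto simp: bij_betw_def)
    have dom: "V0 \<in> pdom k chi" "V2 \<in> pdom k chi" using c(2) L by auto
    have P0: "psub 0 P0" "P0 \<subseteq> M" "P0 \<subseteq> U"
      using pt[OF dom(1)] M(2) im[OF L(1)] V0 dom(1) by (auto simp: P0_def pdom_def)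
    have P2: "psub 0 P2" "P2 \<subseteq> M" "P2 \<subseteq> V2"
      using pt[OF dom(2)] M(2) im[OF L(3)] inc dom(2) by (auto simp: P2_def)
    have P1M: "P1 \<subseteq> M" using M(2) im[OF L(2)] V1 by auto
    have "P0 \<noteq> P1" using P0 nP by auto
    \<comment> \<open>The image line \<open>M\<close> joins \<open>P0\<close> to \<open>P1\<close>,
      hence lies in \<open>V1\<close>; so \<open>P2\<close> lies in \<open>U\<close>, and then
      \<open>M\<close>, which also joins \<open>P0\<close> to \<open>P2\<close>, lies in
      \<open>U\<close> together with \<open>P1\<close>.\<close>
    have "M \<subseteq> V1"
      using points_span_line[OF M(1) P0(1) P1(2) \<open>P0 \<noteq> P1\<close> P0(2) P1M, of V1] P0 P1 V V' vsub_subspace by blast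
    then have "P2 \<subseteq> U" using P2 int by blast
    have "P0 \<noteq> P2" unfolding P0_def P2_def
      using c(3) L V2(4) by (metis bij_betw_imp_inj_on inj_onD)
    have "M \<subseteq> U"
      using points_span_line[OF M(1) P0(1) P2(1) \<open>P0 \<noteq> P2\<close> P0(2) P2(2), of U] P0 \<open>P2 \<subseteq> U\<close> U vsub_subspace by blast
    then show False using P1M nP by blast
  qed
qed

definition pole_complex :: "nat \<Rightarrow> (('a::field ^ 'n) set \<Rightarrow> ('a ^ 'n) set option) \<Rightarrow> ('a ^ 'n) set set" where
  "pole_complex h chi = {X. psub h X \<and>
     (\<forall>V. psub (Suc h) V \<and> X \<subseteq> V \<and> chi V \<noteq> None \<longrightarrow> the (chi V) \<subseteq> X)}"

lemma pole_complexI: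
  assumes lin: "linear_mapping_pts (Suc h) chi" and inc: "\<forall>V \<in> pdom (Suc h) chi. the (chi V) \<subseteq> V"
    and V: "psub (Suc h) V" "chi V = None \<or> the (chi V) \<subseteq> X" and X: "psub h X" "X \<subseteq> V"
  shows "X \<in> pole_complex h chi"
  unfolding pole_complex_def
proof (intro CollectI conjI allI impI; (elim conjE)?)
  fix V1 assume V1: "psub (Suc h) V1" "X \<subseteq> V1" "chi V1 \<noteq> None"
  have "vsub (Suc h) X" using X by (simp add: psub_iff_vsub)
  from linear_mapping_pencil[OF lin inc this V(1) V1(1) X(2) V1(2) V(2)] V1(3)
  show "the (chi V1) \<subseteq> X" by auto
qed (rule X)

lemma pole_complex_iff:
  assumes lin: "linear_mapping_pts (Suc h) chi" and inc: "\<forall>V \<in> pdom (Suc h) chi. the (chi V) \<subseteq> V"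
    and V: "psub (Suc h) V" "chi V = Some P" and X: "psub h X" "X \<subseteq> V"
  shows "X \<in> pole_complex h chi \<longleftrightarrow> P \<subseteq> X"
proof
  assume "X \<in> pole_complex h chi"
  then have "chi V \<noteq> None \<longrightarrow> the (chi V) \<subseteq> X" using V X unfolding pole_complex_def by blast
  then show "P \<subseteq> X" using V by simp
qed (use pole_complexI[OF lin inc V(1) _ X] V in simp)

lemma span_insert_scale_add:
  assumes "c \<noteq> 0" "y \<in> vec.span S"
  shows "vec.span (insert (c *s x + y) S) = vec.span (insert x S)"
proof (rule vec.span_eq[THEN iffD2], intro conjI subsetI)
  have y: "y \<in> vec.span (insert z S)" for z using assms(2) vec.span_mono[of S "insert z S"] by auto
  fix z
  show "z \<in> vec.span (insert x S)" if "z \<in> insert (c *s x + y) S"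
    using that y by (auto intro!: vec.span_add vec.span_scale intro: vec.span_base)
  show "z \<in> vec.span (insert (c *s x + y) S)" if "z \<in> insert x S"
  proof -
    have "inverse c *s ((c *s x + y) - y) \<in> vec.span (insert (c *s x + y) S)"
      by (intro vec.span_scale vec.span_diff y) (auto intro: vec.span_base)
    then show ?thesis using that assms(1) by (auto intro: vec.span_base)
  qed
qed

definition list_in_complex :: "('a::field ^ 'n) set set \<Rightarrow> ('a ^ 'n) list \<Rightarrow> bool" where
  "list_in_complex K xs \<longleftrightarrow> (distinct xs \<and> vec.independent (set xs) \<longrightarrow> vec.span (set xs) \<in> K)"

text \<open>For an independent tail with span \<open>U\<close>, a head \<open>p\<close> is
  admissible iff it lies in \<open>U\<close> or its join \<open>j p\<close> with \<open>U\<close> is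
  in \<open>K\<close>. Two distinct joins lie in one \<open>(h+1)\<close>-subspace, where the
  alternative assumed about \<open>K\<close> settles both the closure under sums and the
  codimension.\<close>

lemma alt_zero_set_complex:
  fixes K :: "('a::field ^ 'n) set set"
  assumes K: "\<And>V. psub (Suc h) V \<Longrightarrow> (\<forall>X. psub h X \<and> X \<subseteq> V \<longrightarrow> X \<in> K) \<or>
    (\<exists>P. psub 0 P \<and> P \<subseteq> V \<and> (\<forall>X. psub h X \<and> X \<subseteq> V \<longrightarrow> (X \<in> K \<longleftrightarrow> P \<subseteq> X)))"
  shows "alt_zero_set (Suc h) UNIV (list_in_complex K)"
proof -
  have main: "vec.subspace {p. list_in_complex K (p # us)} \<and>
      (\<exists>a b. (a \<noteq> 0 \<or> b \<noteq> 0) \<and> list_in_complex K ((a *s p + b *s q) # us))"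
    if len: "length us = h" for us p q
  proof (cases "distinct us \<and> vec.independent (set us)")
    case False
    then have "list_in_complex K (p # us)" for p
      using vec.independent_mono by (auto simp: list_in_complex_def)
    then show ?thesis by (auto simp: vec.subspace_def intro: exI[of _ 1])
  next
    case us: True
    define U where "U = vec.span (set us)"
    define j where "j p = vec.span (insert p (set us))" for p
    have U: "vsub h U" "vec.subspace U"
      using us len by (auto simp: U_def vsub_def vec.dim_eq_card_independent distinct_card)
    have jU: "j p = vec.span (insert p U)" for p unfolding j_def U_def
      by (simp add: vec.span_insert vec.span_span)
    have Z: "list_in_complex K (p # us) \<longleftrightarrow> p \<in> U \<or> j p \<in> K" for p
      using us vec.span_base[of p "set us"]
      by (auto simp: list_in_complex_def vec.independent_insert U_def j_def)
    have j: "psub h (j p)" if "p \<notin> U" for p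
      using vsub_insert[OF U(1) that] by (simp add: jU psub_iff_vsub)
    have Uj: "U \<subseteq> j p" "p \<in> j p" for p
      unfolding j_def U_def by (intro vec.span_mono, auto intro: vec.span_base)
    have j_eq: "j (c *s p + y) = j p" if "c \<noteq> 0" "y \<in> U" for c p y
      unfolding j_def using that by (intro span_insert_scale_add) (auto simp: U_def)
    have in_j: "\<exists>c. q - c *s p \<in> U" if "q \<in> j p" for p q
      using that by (auto simp: j_def U_def vec.span_insert)
    have line: "psub (Suc h) (vec.span (insert q (j p)))" if "p \<notin> U" "q \<notin> j p" for p q
      using vsub_insert[of "Suc h" "j p" q] j[OF that(1)] that(2) by (simp add: psub_iff_vsub)
    have j_sub: "j (a *s p + b *s q) \<subseteq> vec.span (insert q (j p))" for a b p q
    proof -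
      have "U \<subseteq> vec.span (insert q (j p))" "p \<in> vec.span (insert q (j p))" "q \<in> vec.span (insert q (j p))"
        using Uj[of p] by (auto intro: vec.span_base)
      then show ?thesis unfolding jU
        by (intro vec.span_minimal) (auto simp flip: jU intro: vec.span_add vec.span_scale)
    qed
    let ?A = "{p. p \<in> U \<or> j p \<in> K}"
    have scale: "c *s p \<in> ?A" if "p \<in> ?A" for c p
    proof (cases "c = 0")
      case False
      then show ?thesis using that j_eq[of c 0 p] vec.subspace_scale[OF U(2)] vec.subspace_0[OF U(2)] by auto
    qed (simp add: vec.subspace_0[OF U(2)])
    have add: "p + q \<in> ?A" if A: "p \<in> ?A" "q \<in> ?A" for p q
    proof (cases "p \<in> U \<or> q \<in> U")
      case True
      then show ?thesis using A j_eq[of 1 q p] j_eq[of 1 p q] vec.subspace_add[OF U(2), of p q]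
        by (auto simp: add.commute)
    next
      case pq: False
      show ?thesis
      proof (cases "q \<in> j p")
        case True
        then obtain c where c: "q - c *s p \<in> U" using in_j by blast
        have eq: "p + q = (1 + c) *s p + (q - c *s p)" by (simp add: vec_eq_iff algebra_simps)
        show ?thesis
        proof (cases "1 + c = 0")
          case True
          then show ?thesis using c unfolding eq by simp
        next
          case False
          then show ?thesis using j_eq[OF False c, of p] A pq unfolding eq by simp
        qed
      next
        case False
        let ?V = "vec.span (insert q (j p))"
        have pU: "p \<notin> U" using pq by blast
        have pqU: "p + q \<notin> U"
          using False Uj[of p] vec.span_diff[of "p + q" "insert p (set us)" p] by (auto simp: j_def)
        have sub: "j p \<subseteq> ?V" "j q \<subseteq> ?V" "j (p + q) \<subseteq> ?V"
          using j_sub[of 1 p 0 q] j_sub[of 0 p 1 q] j_sub[of 1 p 1 q] by auto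
        have ps: "psub h (j p)" "psub h (j q)" "psub h (j (p + q))" using j pq pqU by auto
        have "j (p + q) \<in> K"
          using K[OF line[OF pU False]]
        proof (elim disjE exE conjE)
          fix P assume P: "\<forall>X. psub h X \<and> X \<subseteq> ?V \<longrightarrow> (X \<in> K \<longleftrightarrow> P \<subseteq> X)"
          then have "P \<subseteq> j p" "P \<subseteq> j q" using A pq ps sub by auto
          \<comment> \<open>The pole lies in two distinct joins, hence in \<open>U\<close>, hence in
            every join.\<close>
          moreover have "j p \<inter> j q = U"
            using ps Uj False by (intro vsub_inter[OF U(1)]) (auto simp: psub_iff_vsub)
          ultimately have "P \<subseteq> j (p + q)" using Uj[of "p + q"] by blast
          then show ?thesis using P ps sub by blast
        qed (use ps sub in auto)
        then show ?thesis by simp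
      qed
    qed
    have "\<exists>a b. (a \<noteq> 0 \<or> b \<noteq> 0) \<and> a *s p + b *s q \<in> ?A"
    proof (cases "p \<in> ?A \<or> q \<in> j p")
      case True
      then show ?thesis
      proof
        assume "p \<in> ?A"
        then show ?thesis by (intro exI[of _ 1] exI[of _ 0]) simp
      next
        assume "q \<in> j p"
        then obtain c where "q - c *s p \<in> U" using in_j by blast
        then show ?thesis by (intro exI[of _ "- c"] exI[of _ 1]) (simp add: add.commute vec.scale_minus_left)
      qed
    next
      case False
      let ?V = "vec.span (insert q (j p))"
      have sub: "j p \<subseteq> ?V" using j_sub[of 1 p 0 q] by auto
      have jp: "psub h (j p)" "j p \<notin> K" "p \<notin> U" "q \<notin> j p" using False j by auto
      then obtain P where P: "psub 0 P" "P \<subseteq> ?V" "\<And>X. psub h X \<Longrightarrow> X \<subseteq> ?V \<Longrightarrow> X \<in> K \<longleftrightarrow> P \<subseteq> X"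
        using K[OF line[OF jp(3,4)]] sub by blast
      \<comment> \<open>Modulo \<open>U\<close> the pole is represented by some
        \<open>a *s p + b *s q\<close>, whose join with \<open>U\<close> therefore passes through
        the pole. Both coefficients zero would put the pole into \<open>U\<close> and so
        \<open>j p\<close> into \<open>K\<close>.\<close>
      obtain w where w: "w \<in> P" "P = vec.span {w}" using point_nonzero[OF P(1)] by blast
      have "w \<in> ?V" using w P by blast
      moreover have "?V = vec.span (insert q (insert p (set us)))"
        unfolding j_def by (simp add: vec.span_insert[of q] vec.span_span)
      ultimately obtain b where "w - b *s q \<in> j p" by (auto simp: vec.span_insert[of q] j_def)
      then obtain a where a: "w - b *s q - a *s p \<in> U" using in_j by blast
      let ?r = "a *s p + b *s q"
      have "w - ?r \<in> U" using a by (simp add: algebra_simps)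
      have PX: "P \<subseteq> j ?r"
      proof -
        have "(w - ?r) + ?r \<in> j ?r"
          using \<open>w - ?r \<in> U\<close> Uj[of ?r] unfolding j_def by (intro vec.span_add[where y = ?r]) blast+
        then show ?thesis unfolding w(2) j_def by (intro vec.span_minimal) auto
      qed
      have "?r \<in> ?A"
      proof (cases "?r \<in> U")
        case False
        then have "j ?r \<in> K" using P(3)[OF j[OF False] j_sub] PX by blast
        then show ?thesis by simp
      qed simp
      moreover have "a \<noteq> 0 \<or> b \<noteq> 0"
      proof (rule ccontr)
        assume "\<not> ?thesis"
        then have "w \<in> U" using \<open>w - ?r \<in> U\<close> by simp
        then have "P \<subseteq> j p" unfolding w(2) using Uj[of p] U by (intro vec.span_minimal) (auto simp: j_def)
        then show False using P(3)[OF jp(1) sub] jp by blast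
      qed
      ultimately show ?thesis by blast
    qed
    then show ?thesis using scale add vec.subspace_0[OF U(2)] unfolding Z by (auto simp: vec.subspace_def)
  qed
  show ?thesis
  proof
    fix as x y bs assume "list_in_complex K (as @ x # y # bs)"
    moreover have "set (as @ y # x # bs) = set (as @ x # y # bs)" by auto
    moreover have "distinct (as @ y # x # bs) \<longleftrightarrow> distinct (as @ x # y # bs)" by auto
    ultimately show "list_in_complex K (as @ y # x # bs)" unfolding list_in_complex_def by presburger
  qed (use main in \<open>auto simp: list_in_complex_def\<close>)
qed

subsection \<open>Linear complexes and poles\<close>

lemma subspace_basis_list:
  assumes "vec.subspace X" "A \<subseteq> X" "vec.independent A"
  obtains xs where "length xs = vec.dim X" "distinct xs" "vec.independent (set xs)" "vec.span (set xs) = X" "A \<subseteq> set xs"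
proof -
  obtain B where B: "A \<subseteq> B" "B \<subseteq> X" "vec.independent B" "X \<subseteq> vec.span B"
    using vec.maximal_independent_subset_extend[OF assms(2,3)] by blast
  obtain xs where xs: "set xs = B" "distinct xs"
    using finite_distinct_list[OF vec.finiteI_independent[OF B(3)]] by blast
  have "length xs = vec.dim X" using xs B vec.basis_card_eq_dim[OF B(2,4,3)] distinct_card by fastforce
  moreover have "vec.span B = X" using vec.span_subspace[OF B(2,4) assms(1)] .
  ultimately show ?thesis using that xs B by blast
qed

lemma psub_span_list:
  "length xs = Suc h \<Longrightarrow> distinct xs \<Longrightarrow> vec.independent (set xs) \<Longrightarrow> psub h (vec.span (set xs))"
  by (simp add: psub_def vec.dim_eq_card_independent distinct_card)

lemma psub_basis_list:
  assumes "psub h X"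
  obtains xs where "length xs = Suc h" "distinct xs" "vec.independent (set xs)" "vec.span (set xs) = X"
  using subspace_basis_list[of X "{}"] assms by (auto simp: psub_def vec.independent_empty)

lemma subseqs_full: "ys \<in> set (subseqs xs) \<Longrightarrow> length xs \<le> length ys \<Longrightarrow> ys = xs"
proof (induction xs arbitrary: ys)
  case (Cons x xs)
  have "length zs \<le> length xs" if "zs \<in> set (subseqs xs)" for zs
    using that by (induction xs arbitrary: zs) (force simp: Let_def)+
  then show ?case using Cons by (force simp: Let_def)
qed simp

lemma subseqs_drop_one:
  "ys \<in> set (subseqs xs) \<Longrightarrow> Suc (length ys) = length xs \<Longrightarrow>
    \<exists>i<length xs. ys = take i xs @ drop (Suc i) xs"
proof (induction xs arbitrary: ys)
  case (Cons x xs)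
  from Cons.prems(1) consider ys' where "ys = x # ys'" "ys' \<in> set (subseqs xs)" | "ys \<in> set (subseqs xs)"
    by (auto simp: Let_def)
  then show ?case
  proof cases
    case 1
    then obtain i where "i < length xs" "ys' = take i xs @ drop (Suc i) xs"
      using Cons.IH[of ys'] Cons.prems by auto
    then show ?thesis using 1 by (intro exI[of _ "Suc i"]) simp
  next
    case 2
    then have "ys = xs" using subseqs_full[of ys xs] Cons.prems by simp
    then show ?thesis by (intro exI[of _ 0]) simp
  qed
qed simp

text \<open>\<open>alt_form\<close> takes functions on the natural numbers but reads only the first
  \<open>m\<close> values, so padding a list with 0 is harmless.\<close>

lemma alternating_of_alt_form:
  assumes "alt_form m f"
  shows "alternating m (\<lambda>xs. f (\<lambda>i. if i < m then xs ! i else 0))"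
  unfolding alternating_def
proof (intro conjI allI impI)
  fix as bs :: "('a ^ 'b) list" and x y a b assume len: "length as + length bs + 1 = m"
  let ?v = "\<lambda>xs i. if i < m then xs ! i else 0"
  have upd: "?v (as @ z # bs) = (?v (as @ 0 # bs)) (length as := z)" for z
    using len by (auto simp: fun_eq_iff nth_append nth_Cons')
  have lin: "f (v(length as := a *s x + b *s y)) = a * f (v(length as := x)) + b * f (v(length as := y))" for v
    using assms len unfolding alt_form_def by simp
  show "f (?v (as @ (a *s x + b *s y) # bs)) = a * f (?v (as @ x # bs)) + b * f (?v (as @ y # bs))"
    unfolding upd[of "a *s x + b *s y"] upd[of x] upd[of y] by (rule lin)
next
  fix as bs :: "('a ^ 'b) list" and x assume len: "length as + length bs + 2 = m"
  let ?v = "\<lambda>i. if i < m then (as @ x # x # bs) ! i else 0"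
  have eq: "?v (length as) = ?v (Suc (length as))" using len by (simp add: nth_append)
  have alt: "\<And>v i j. i < m \<Longrightarrow> j < m \<Longrightarrow> i \<noteq> j \<Longrightarrow> v i = v j \<Longrightarrow> f v = 0"
    using assms unfolding alt_form_def by blast
  show "f ?v = 0" by (rule alt[OF _ _ _ eq]) (use len in auto)
qed

lemma alt_form_of_alternating:
  fixes F :: "('a::field ^ 'n) list \<Rightarrow> 'a"
  assumes F: "alternating m F"
  shows "alt_form m (\<lambda>v. F (map v [0..<m]))"
  unfolding alt_form_def
proof (intro conjI allI impI)
  fix v w :: "nat \<Rightarrow> 'a ^ 'n" assume "\<forall>i<m. v i = w i"
  then have "map v [0..<m] = map w [0..<m]" by simp
  then show "F (map v [0..<m]) = F (map w [0..<m])" by (rule arg_cong)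
next
  fix i and v :: "nat \<Rightarrow> 'a ^ 'n" and x y a b assume i: "i < m"
  have "[0..<m] = [0..<i] @ i # [Suc i..<m]"
    using i by (metis le_add_same_cancel1 less_imp_le_nat upt_add_eq_append upt_conv_Cons zero_le le_add_diff_inverse)
  then have upd: "map (v(i := z)) [0..<m] = map v [0..<i] @ z # map v [Suc i..<m]" for z
    by simp
  show "F (map (v(i := a *s x + b *s y)) [0..<m])
      = a * F (map (v(i := x)) [0..<m]) + b * F (map (v(i := y)) [0..<m])"
    unfolding upd by (rule alternating_lincomb[OF F]) (use i in simp)
next
  fix v :: "nat \<Rightarrow> 'a ^ 'n" and i j assume ij: "i < m" "j < m" "i \<noteq> j" "v i = v j"
  \<comment> \<open>The locale turns vanishing on adjacent repeats into vanishing on repeats at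
    arbitrary positions.\<close>
  interpret alt_zero_set m UNIV "\<lambda>xs. F xs = 0" using alt_zero_set_alternating[OF F] by simp
  have "\<not> distinct (map v [0..<m])" using ij by (auto simp: distinct_map dest: inj_onD)
  then show "F (map v [0..<m]) = 0" by (intro not_distinct) auto
qed

text \<open>The definition asks for some basis on which the form vanishes. By
  \<open>alternating_vanish_span\<close> vanishing on one basis forces it on every other, so
  membership can be tested on any given basis.\<close>

lemma linear_complex_iff_list:
  fixes K :: "('a::field ^ 'n) set set"
  shows "linear_complex h K \<longleftrightarrow> (\<exists>F. alternating (Suc h) F \<and> (\<exists>xs. length xs = Suc h \<and> F xs \<noteq> 0) \<and>
    (\<forall>X\<in>K. psub h X) \<and> (\<forall>xs. length xs = Suc h \<longrightarrow> distinct xs \<longrightarrow> vec.independent (set xs) \<longrightarrow>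
      (vec.span (set xs) \<in> K \<longleftrightarrow> F xs = 0)))"
proof
  assume "linear_complex h K"
  then obtain f where f: "alt_form (Suc h) f" "\<exists>v. f v \<noteq> 0"
    and K: "K = {X. psub h X \<and> (\<exists>v. inj_on v {..h} \<and> vec.independent (v ` {..h}) \<and>
                              vec.span (v ` {..h}) = X \<and> f v = 0)}"
    unfolding linear_complex_def by blast
  define F where "F xs = f (\<lambda>i. if i < Suc h then xs ! i else 0)" for xs
  have F: "alternating (Suc h) F" unfolding F_def by (rule alternating_of_alt_form[OF f(1)])
  have ext: "f v = f w" if "\<And>i. i < Suc h \<Longrightarrow> v i = w i" for v w
    using f(1) that unfolding alt_form_def by blast
  have Ff: "F (map v [0..<Suc h]) = f v" for v
    unfolding F_def by (rule ext) (simp del: upt_Suc)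
  have Fn: "F xs = f (\<lambda>i. xs ! i)" for xs
    unfolding F_def by (rule ext) simp
  obtain v where "f v \<noteq> 0" using f(2) by blast
  then have "\<exists>xs. length xs = Suc h \<and> F xs \<noteq> 0"
    using Ff by (intro exI[of _ "map v [0..<Suc h]"]) (simp del: upt_Suc)
  moreover have "vec.span (set xs) \<in> K \<longleftrightarrow> F xs = 0"
    if xs: "length xs = Suc h" "distinct xs" "vec.independent (set xs)" for xs
  proof
    assume "vec.span (set xs) \<in> K"
    then obtain v where v: "vec.span (v ` {..h}) = vec.span (set xs)" "f v = 0" unfolding K by blast
    have set: "set (map v [0..<Suc h]) = v ` {..h}"
      by (simp add: atLeast0LessThan lessThan_Suc_atMost del: upt_Suc)
    show "F xs = 0"
    proof (rule alternating_vanish_span[OF F _ xs(1)])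
      show "F ys = 0" if "ys \<in> set (subseqs (map v [0..<Suc h]))" "length ys = Suc h" for ys
        using subseqs_full[OF that(1)] that(2) Ff v(2) by (simp del: upt_Suc)
      show "set xs \<subseteq> vec.span (set (map v [0..<Suc h]))"
        unfolding set v(1) by (auto intro: vec.span_base)
    qed
  next
    assume "F xs = 0"
    then have "f (\<lambda>i. xs ! i) = 0" by (simp add: Fn)
    moreover have "(\<lambda>i. xs ! i) ` {..h} = set xs" using xs(1) by (auto simp: set_conv_nth less_Suc_eq_le)
    moreover have "inj_on (\<lambda>i. xs ! i) {..h}" using xs by (auto simp: inj_on_def nth_eq_iff_index_eq)
    ultimately show "vec.span (set xs) \<in> K"
      unfolding K using psub_span_list[OF xs] xs(3) by (intro CollectI conjI exI[of _ "\<lambda>i. xs ! i"]) auto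
  qed
  ultimately show "\<exists>F. alternating (Suc h) F \<and> (\<exists>xs. length xs = Suc h \<and> F xs \<noteq> 0) \<and>
    (\<forall>X\<in>K. psub h X) \<and> (\<forall>xs. length xs = Suc h \<longrightarrow> distinct xs \<longrightarrow> vec.independent (set xs) \<longrightarrow>
      (vec.span (set xs) \<in> K \<longleftrightarrow> F xs = 0))"
    using F K by (intro exI[of _ F]) blast
next
  assume "\<exists>F. alternating (Suc h) F \<and> (\<exists>xs. length xs = Suc h \<and> F xs \<noteq> 0) \<and>
    (\<forall>X\<in>K. psub h X) \<and> (\<forall>xs. length xs = Suc h \<longrightarrow> distinct xs \<longrightarrow> vec.independent (set xs) \<longrightarrow>
      (vec.span (set xs) \<in> K \<longleftrightarrow> F xs = 0))"
  then obtain F xs0 where F: "alternating (Suc h) F" and xs0: "length xs0 = Suc h" "F xs0 \<noteq> 0"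
    and K: "\<And>X. X \<in> K \<Longrightarrow> psub h X" and iff: "\<And>xs. length xs = Suc h \<Longrightarrow> distinct xs \<Longrightarrow>
      vec.independent (set xs) \<Longrightarrow> vec.span (set xs) \<in> K \<longleftrightarrow> F xs = 0" by blast
  define f where "f v = F (map v [0..<Suc h])" for v
  have f: "alt_form (Suc h) f" unfolding f_def by (rule alt_form_of_alternating[OF F])
  have fn: "f (\<lambda>i. xs ! i) = F xs" if "length xs = Suc h" for xs
    unfolding f_def using that map_nth[of xs] by simp
  have "X \<in> K \<longleftrightarrow> psub h X \<and> (\<exists>v. inj_on v {..h} \<and> vec.independent (v ` {..h}) \<and>
                              vec.span (v ` {..h}) = X \<and> f v = 0)" for X
  proof safe
    assume X: "X \<in> K"
    then show "psub h X" by (rule K)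
    then obtain xs where xs: "length xs = Suc h" "distinct xs" "vec.independent (set xs)" "vec.span (set xs) = X"
      using psub_basis_list by blast
    have "(\<lambda>i. xs ! i) ` {..h} = set xs" using xs(1) by (auto simp: set_conv_nth less_Suc_eq_le)
    moreover have "inj_on (\<lambda>i. xs ! i) {..h}" using xs by (auto simp: inj_on_def nth_eq_iff_index_eq)
    moreover have "f (\<lambda>i. xs ! i) = 0" using iff[OF xs(1-3)] xs X fn by simp
    ultimately show "\<exists>v. inj_on v {..h} \<and> vec.independent (v ` {..h}) \<and> vec.span (v ` {..h}) = X \<and> f v = 0"
      using xs by (intro exI[of _ "\<lambda>i. xs ! i"]) auto
  next
    fix v assume v: "inj_on v {..h}" "vec.independent (v ` {..h})" "f v = 0"
    have set: "set (map v [0..<Suc h]) = v ` {..h}"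
      by (simp add: atLeast0LessThan lessThan_Suc_atMost del: upt_Suc)
    have "distinct (map v [0..<Suc h])"
      using v(1) by (simp add: distinct_map atLeast0LessThan lessThan_Suc_atMost del: upt_Suc)
    then show "vec.span (v ` {..h}) \<in> K"
      using iff[of "map v [0..<Suc h]"] v set by (simp add: f_def del: upt_Suc)
  qed
  then show "linear_complex h K"
    unfolding linear_complex_def using f fn[OF xs0(1)] xs0(2)
    by (intro exI[of _ f] conjI exI[of _ "\<lambda>i. xs0 ! i"]) auto
qed

section \<open>Poles of non-total subspaces\<close>

lemma functional_sum: "functional t \<Longrightarrow> t (\<Sum>i\<in>I. v i) = (\<Sum>i\<in>I. t (v i))"
proof (induction I rule: infinite_finite_induct)
  case (insert i I)
  then show ?case by (simp add: functional_add)
qed (use functional_scale[of t 0 0] in simp_all)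

text \<open>On \<open>V\<close> the form has degree one less than the vector dimension, so some
  nonzero \<open>p\<close> in \<open>V\<close> contracts it to zero there. Such a \<open>p\<close>
  spans the pole.\<close>

lemma linear_complex_pole_exists:
  assumes K: "linear_complex h K" and V: "psub (Suc h) V" and nt: "\<not> total h K V"
  shows "\<exists>P. psub 0 P \<and> P \<subseteq> V \<and> (\<forall>X. psub h X \<and> X \<subseteq> V \<longrightarrow> (X \<in> K \<longleftrightarrow> P \<subseteq> X))"
proof -
  obtain F where F: "alternating (Suc h) F" and iff: "\<And>xs. length xs = Suc h \<Longrightarrow> distinct xs \<Longrightarrow>
      vec.independent (set xs) \<Longrightarrow> vec.span (set xs) \<in> K \<longleftrightarrow> F xs = 0"
    using K unfolding linear_complex_iff_list by blast
  interpret alt_zero_set "Suc h" UNIV "\<lambda>xs. F xs = 0" using alt_zero_set_alternating[OF F] by simp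
  obtain X0 where X0: "psub h X0" "X0 \<subseteq> V" "X0 \<notin> K" using nt by (auto simp: total_def)
  obtain xs where xs: "length xs = Suc h" "distinct xs" "vec.independent (set xs)" "vec.span (set xs) = X0"
    using psub_basis_list[OF X0(1)] .
  have Fxs: "F xs \<noteq> 0" using iff[OF xs(1-3)] xs(4) X0(3) by simp
  have vX0: "vsub (Suc h) X0" and vV: "vsub (Suc (Suc h)) V" using X0 V by (auto simp: psub_iff_vsub)
  obtain v where v: "v \<in> V" "v \<notin> X0" using vsub_not_subset[OF vX0 vV] by blast
  define rm where "rm i = take i xs @ drop (Suc i) xs" for i
  \<comment> \<open>Putting \<open>xs ! j\<close> before \<open>rm i\<close> repeats an entry unless
    \<open>j = i\<close>. Hence subtracting these multiples from \<open>v\<close> makes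
    \<open>F (p # rm i)\<close> vanish for every \<open>i\<close>; the denominators are nonzero
    because \<open>F xs\<close> is.\<close>
  define c where "c i = F (v # rm i) / F (xs ! i # rm i)" for i
  define p where "p = v - (\<Sum>i<Suc h. c i *s xs ! i)"
  have xsX: "set xs \<subseteq> X0" using xs(4) vec.span_superset by blast
  have sumX: "(\<Sum>i<Suc h. c i *s xs ! i) \<in> X0"
    unfolding xs(4)[symmetric] using xs(1) by (intro vec.span_sum vec.span_scale vec.span_base) auto
  have "p \<notin> X0" using v sumX vec.subspace_add[OF vsub_subspace[OF vX0], of p "(\<Sum>i<Suc h. c i *s xs ! i)"]
    by (auto simp: p_def)
  have pV: "p \<in> V" unfolding p_def using v sumX X0 vsub_subspace[OF vV] by (auto intro: vec.subspace_diff)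
  have "p \<noteq> 0" using \<open>p \<notin> X0\<close> vec.subspace_0[OF vsub_subspace[OF vX0]] by auto
  have lrm: "length (rm i) = h" if "i < Suc h" for i using xs(1) that by (simp add: rm_def)
  have rm0: "F (p # rm i) = 0" if i: "i < Suc h" for i
  proof -
    have t: "functional (\<lambda>w. F (w # rm i))"
      using alternating_functional[OF F, of "[]" "rm i"] lrm[OF i] by simp
    have xi: "F (xs ! i # rm i) \<noteq> 0"
      using move[of "take i xs" "drop (Suc i) xs" "[]" "xs ! i"] id_take_nth_drop[of i xs] i xs(1) Fxs
      by (simp add: rm_def)
    have other: "F (xs ! j # rm i) = 0" if j: "j < Suc h" "j \<noteq> i" for j
    proof (rule not_distinct)
      have "xs ! j \<in> set (rm i)"
      proof (cases "j < i")
        case True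
        then have "xs ! j = take i xs ! j" "j < length (take i xs)" using i xs(1) by auto
        then show ?thesis unfolding rm_def by (metis UnCI nth_mem set_append)
      next
        case False
        then have "xs ! j = drop (Suc i) xs ! (j - Suc i)" "j - Suc i < length (drop (Suc i) xs)"
          using j xs(1) by auto
        then show ?thesis unfolding rm_def by (metis UnCI nth_mem set_append)
      qed
      then show "\<not> distinct (xs ! j # rm i)" by simp
    qed (use lrm[OF i] in simp_all)
    have "F (p # rm i) = F (v # rm i) - (\<Sum>j<Suc h. c j * F (xs ! j # rm i))"
      unfolding p_def using functional_diff[OF t, of v] functional_sum[OF t, of "\<lambda>j. c j *s xs ! j" "{..<Suc h}"]
      by (simp only: functional_scale[OF t])
    also have "(\<Sum>j<Suc h. c j * F (xs ! j # rm i)) = (\<Sum>j<Suc h. if j = i then F (v # rm i) else 0)"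
      using other xi by (intro sum.cong) (auto simp: c_def)
    also have "\<dots> = F (v # rm i)" using i by (subst sum.delta) auto
    finally show ?thesis by simp
  qed
  have rep: "F (p # p # ys) = 0" if "Suc (length ys) = h" for ys
    using that by (intro not_distinct) auto
  have span_p: "vec.span (insert p X) = V" if "psub h X" "X \<subseteq> V" "p \<notin> X" for X
    using vsub_insert_eq[of "Suc h" X V p] vV that pV by (simp add: psub_iff_vsub)
  \<comment> \<open>\<open>p # xs\<close> spans \<open>V\<close>, and its sublists of length
    \<open>h\<close> either contain \<open>p\<close> again or are one of the
    \<open>rm i\<close>.\<close>
  have pvan: "F (p # zs) = 0" if zs: "length zs = h" "set zs \<subseteq> V" for zs
  proof (rule alternating_vanish_span[OF alternating_contract[OF F] _ zs(1)])
    show "F (p # ys) = 0" if ys: "ys \<in> set (subseqs (p # xs))" "length ys = h" for ys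
    proof -
      from ys(1) consider ys' where "ys = p # ys'" | "ys \<in> set (subseqs xs)" by (auto simp: Let_def)
      then show ?thesis
      proof cases
        case 1
        then show ?thesis using rep ys(2) by auto
      next
        case 2
        then obtain i where "i < Suc h" "ys = rm i"
          using subseqs_drop_one[of ys xs] ys(2) xs(1) by (auto simp: rm_def)
        then show ?thesis using rm0 by simp
      qed
    qed
    have "vec.span (set (p # xs)) = V"
      using span_p[OF X0(1,2) \<open>p \<notin> X0\<close>] xs(4) by (auto simp: vec.span_insert vec.span_span)
    then show "set zs \<subseteq> vec.span (set (p # xs))" using zs by simp
  qed
  have "X \<in> K \<longleftrightarrow> vec.span {p} \<subseteq> X" if X: "psub h X" "X \<subseteq> V" for X
  proof
    assume XK: "X \<in> K"
    have sX: "vec.subspace X" using X by (simp add: psub_def)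
    have "p \<in> X"
    proof (rule ccontr)
      assume p: "p \<notin> X"
      obtain ys where ys: "length ys = Suc h" "distinct ys" "vec.independent (set ys)" "vec.span (set ys) = X"
        using psub_basis_list[OF X(1)] .
      have ysX: "set ys \<subseteq> X" using ys(4) vec.span_superset by blast
      \<comment> \<open>With \<open>X\<close> in \<open>K\<close> and \<open>p\<close> outside it,
        \<open>F\<close> would vanish on every sublist of length \<open>Suc h\<close> of the
        spanning list \<open>p # ys\<close>, hence on all of \<open>V\<close>.\<close>
      have "F xs = 0"
      proof (rule alternating_vanish_span[OF F _ xs(1)])
        show "F zs = 0" if zs: "zs \<in> set (subseqs (p # ys))" "length zs = Suc h" for zs
        proof -
          from zs(1) consider zs' where "zs = p # zs'" "zs' \<in> set (subseqs ys)" | "zs \<in> set (subseqs ys)"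
            by (auto simp: Let_def)
          then show ?thesis
          proof cases
            case 1
            then have "set zs' \<subseteq> set ys" using subseqs_powset[of ys] by blast
            then show ?thesis using 1 pvan[of zs'] zs(2) ysX X(2) by auto
          next
            case 2
            then have "zs = ys" using subseqs_full[of zs ys] zs(2) ys(1) by simp
            then show ?thesis using iff[OF ys(1-3)] ys(4) XK by simp
          qed
        qed
        have "vec.span (set (p # ys)) = V"
          using span_p[OF X p] ys(4) by (auto simp: vec.span_insert vec.span_span)
        then show "set xs \<subseteq> vec.span (set (p # ys))" using xsX X0(2) by simp
      qed
      then show False using Fxs by simp
    qed
    then show "vec.span {p} \<subseteq> X" using sX by (intro vec.span_minimal) auto
  next
    assume "vec.span {p} \<subseteq> X"
    then have "p \<in> X" using vec.span_base[of p "{p}"] by blast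
    then obtain ys where ys: "length ys = vec.dim X" "distinct ys" "vec.independent (set ys)"
      "vec.span (set ys) = X" "{p} \<subseteq> set ys"
      using subspace_basis_list[of X "{p}"] X(1) \<open>p \<noteq> 0\<close> by (auto simp: psub_def)
    obtain as bs where ab: "ys = as @ p # bs" using ys(5) split_list[of p ys] by auto
    have len: "length ys = Suc h" using ys(1) X(1) by (simp add: psub_def)
    have "set ys \<subseteq> V" using ys(4) vec.span_superset X(2) by blast
    then have "F (p # as @ bs) = 0" using pvan[of "as @ bs"] ab len by simp
    then have "F ys = 0" using move[of as bs "[]" p] ab len by simp
    then show "X \<in> K" using iff[OF len ys(2,3)] ys(4) by simp
  qed
  moreover have "vec.span {p} \<subseteq> V" using pV vsub_subspace[OF vV] by (intro vec.span_minimal) auto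
  ultimately show ?thesis using psub_0_span[OF \<open>p \<noteq> 0\<close>] by blast
qed

text \<open>Extend \<open>insert q A\<close> to a basis of \<open>V\<close> and drop
  \<open>q\<close>.\<close>

lemma separating_subspace:
  assumes V: "psub (Suc h) V" and A: "A \<subseteq> V" "q \<in> V" "q \<notin> A" "vec.independent (insert q A)"
  shows "\<exists>X. psub h X \<and> A \<subseteq> X \<and> X \<subseteq> V \<and> q \<notin> X"
proof -
  have "vec.subspace V" using V by (simp add: psub_def)
  then obtain ys where ys: "length ys = vec.dim V" "distinct ys" "vec.independent (set ys)"
      "vec.span (set ys) = V" "insert q A \<subseteq> set ys"
    using subspace_basis_list[of V "insert q A"] A by auto
  obtain as bs where ab: "ys = as @ q # bs" using ys(5) split_list[of q ys] by auto
  let ?X = "vec.span (set (as @ bs))"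
  have "insert q (set (as @ bs)) = set ys" "q \<notin> set (as @ bs)" using ab ys(2) by auto
  then have "vec.independent (set (as @ bs))" "q \<notin> ?X"
    using ys(3) vec.independent_insert[of q "set (as @ bs)"] by auto
  moreover have "psub h ?X" using calculation(1) ab ys(1,2) V by (intro psub_span_list) (auto simp: psub_def)
  moreover have "?X \<subseteq> V" unfolding ys(4)[symmetric] using ab by (intro vec.span_mono) auto
  moreover have "A \<subseteq> ?X" using ys(5) ab A(3) by (auto intro: vec.span_base)
  ultimately show ?thesis by blast
qed

text \<open>A point of \<open>V\<close> is determined by the \<open>h\<close>-subspaces of
  \<open>V\<close> through it. The description in \<open>pole\<close> does not demand that the point
  lie in \<open>V\<close>, so this is derived first for a competitor \<open>Q\<close>.\<close>

lemma pole_eqI: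
  assumes V: "psub (Suc h) V" and P: "psub 0 P" "P \<subseteq> V"
    and iff: "\<And>X. psub h X \<Longrightarrow> X \<subseteq> V \<Longrightarrow> X \<in> K \<longleftrightarrow> P \<subseteq> X"
  shows "pole h K V = P"
  unfolding pole_def
proof (rule the_equality)
  fix Q assume "psub 0 Q \<and> (\<forall>X. psub h X \<and> X \<subseteq> V \<longrightarrow> (X \<in> K \<longleftrightarrow> Q \<subseteq> X))"
  then have Q: "psub 0 Q" and Qiff: "\<And>X. psub h X \<Longrightarrow> X \<subseteq> V \<Longrightarrow> Q \<subseteq> X \<longleftrightarrow> P \<subseteq> X" using iff by auto
  obtain p where p: "p \<in> P" "p \<noteq> 0" "P = vec.span {p}" using point_nonzero[OF P(1)] .
  obtain q where q: "q \<in> Q" "q \<noteq> 0" "Q = vec.span {q}" using point_nonzero[OF Q] .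
  have sep: "\<exists>X. psub h X \<and> p \<in> X \<and> X \<subseteq> V \<and> r \<notin> X" if r: "r \<in> V" "r \<notin> P" for r
  proof -
    have "r \<noteq> p" using r p by auto
    then have "vec.independent (insert r {p})"
      using r p by (auto simp: vec.independent_insert)
    then show ?thesis using separating_subspace[OF V, of "{p}" r] r p P \<open>r \<noteq> p\<close> by auto
  qed
  have PX: "P \<subseteq> X" if "psub h X" "p \<in> X" for X
    unfolding p(3) using that by (intro vec.span_minimal) (auto simp: psub_def)
  \<comment> \<open>Any such \<open>r\<close> serves only to produce some \<open>h\<close>-subspace
    of \<open>V\<close> through \<open>P\<close>; it also contains \<open>Q\<close>, which places
    \<open>Q\<close> in \<open>V\<close>.\<close>
  obtain r where "r \<in> V" "r \<notin> P"
  proof -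
    have "vec.dim V > vec.dim P" using V P by (simp add: psub_def)
    then have "\<not> V \<subseteq> P" using vec.dim_subset[of V P] by auto
    then show thesis using that by blast
  qed
  then obtain X where "psub h X" "p \<in> X" "X \<subseteq> V" using sep by blast
  then have "Q \<subseteq> V" using Qiff PX by blast
  have "q \<in> P"
  proof (rule ccontr)
    assume "q \<notin> P"
    then obtain X where X: "psub h X" "p \<in> X" "X \<subseteq> V" "q \<notin> X" using sep[of q] q \<open>Q \<subseteq> V\<close> by blast
    then show False using Qiff[OF X(1,3)] PX[OF X(1,2)] q by blast
  qed
  then show "Q = P" using point_span[OF P(1) _ q(2)] q(3) by simp
qed (use P iff in auto)

lemma psub_extend:
  fixes X :: "('a::field ^ 'n) set"
  assumes "psub h X" "Suc h < CARD('n)"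
  shows "\<exists>V. psub (Suc h) V \<and> X \<subseteq> V"
proof -
  have "X \<noteq> UNIV" using assms vec_dim_card[where 'a = 'a and 'n = 'n] by (auto simp: psub_def)
  then obtain a where "a \<notin> X" by auto
  then have "psub (Suc h) (vec.span (insert a X))"
    using vsub_insert[of "Suc h" X a] assms by (simp add: psub_iff_vsub)
  then show ?thesis by (meson vec.span_superset subset_insertI subset_trans)
qed

section \<open>Existence and uniqueness of the complex\<close>

theorem theorem5p7:
  fixes chi :: "('a::field ^ 'n) set \<Rightarrow> ('a ^ 'n) set option"
    and h :: nat
  assumes dim: "h + 2 \<le> CARD('n) - 1"
    and lin: "linear_mapping_pts (Suc h) chi"
    and ne: "pdom (Suc h) chi \<noteq> {}"
    and inc: "\<forall>V \<in> pdom (Suc h) chi. the (chi V) \<subseteq> V"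
  shows "\<exists>!K. linear_complex h K \<and>
           (\<forall>V. psub (Suc h) V \<longrightarrow> chi V = dual_polarity h K V)"
proof -
  define K where "K = pole_complex h chi"
  have exc: "X \<in> K" if "psub (Suc h) V" "chi V = None" "psub h X" "X \<subseteq> V" for V X
    unfolding K_def using pole_complexI[OF lin inc] that by blast
  have iff: "X \<in> K \<longleftrightarrow> P \<subseteq> X" if "psub (Suc h) V" "chi V = Some P" "psub h X" "X \<subseteq> V" for V P X
    unfolding K_def using pole_complex_iff[OF lin inc that] .
  have pt: "psub 0 P" "P \<subseteq> V" if "psub (Suc h) V" "chi V = Some P" for V P
  proof -
    have V: "V \<in> pdom (Suc h) chi" using that by (simp add: pdom_def)
    then have "psub 0 (the (chi V))" using lin by (simp add: linear_mapping_pts_def)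
    then show "psub 0 P" using that by simp
    have "the (chi V) \<subseteq> V" using inc V by blast
    then show "P \<subseteq> V" using that by simp
  qed
  \<comment> \<open>Some \<open>h\<close>-subspace of \<open>V\<close> misses the point
    \<open>P\<close>.\<close>
  have nontotal: "\<exists>X. psub h X \<and> X \<subseteq> V \<and> X \<notin> K" if V: "psub (Suc h) V" "chi V = Some P" for V P
  proof -
    obtain p where p: "p \<in> P" "p \<noteq> 0" using point_nonzero[OF pt(1)[OF V]] by blast
    then obtain X where "psub h X" "X \<subseteq> V" "p \<notin> X"
      using separating_subspace[OF V(1), of "{}" p] pt(2)[OF V] by (auto simp: vec.independent_insert)
    then show ?thesis using iff[OF V] p by blast
  qed
  have polarity: "chi V = dual_polarity h K V" if V: "psub (Suc h) V" for V
  proof (cases "chi V")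
    case None
    then have "total h K V" using exc[OF V None] by (simp add: total_def)
    then show ?thesis using None by (simp add: dual_polarity_def)
  next
    case (Some P)
    have "\<not> total h K V" using nontotal[OF V Some] by (auto simp: total_def)
    moreover have "pole h K V = P" using pole_eqI[OF V pt[OF V Some]] iff[OF V Some] by blast
    ultimately show ?thesis using Some V by (simp add: dual_polarity_def)
  qed
  have "(\<forall>X. psub h X \<and> X \<subseteq> V \<longrightarrow> X \<in> K) \<or>
      (\<exists>P. psub 0 P \<and> P \<subseteq> V \<and> (\<forall>X. psub h X \<and> X \<subseteq> V \<longrightarrow> (X \<in> K \<longleftrightarrow> P \<subseteq> X)))"
    if V: "psub (Suc h) V" for V
  proof (cases "chi V")
    case None
    then show ?thesis using exc[OF V] by blast
  next
    case (Some P)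
    then show ?thesis using pt[OF V Some] iff[OF V Some] by blast
  qed
  then have "alt_zero_set (Suc h) UNIV (list_in_complex K)" by (rule alt_zero_set_complex)
  moreover have "vec.span cart_basis = (UNIV :: ('a ^ 'n) set)" by (rule vec.span_Basis)
  ultimately obtain F :: "('a ^ 'n) list \<Rightarrow> 'a" where F: "alternating (Suc h) F"
    and F_iff: "\<And>xs. length xs = Suc h \<Longrightarrow> list_in_complex K xs \<longleftrightarrow> F xs = 0"
    using alt_zero_set_form[of cart_basis "Suc h" "list_in_complex K"] by (auto simp: finite_cart_basis)
  \<comment> \<open>The non-empty domain yields a subspace outside \<open>K\<close>, so the form
    \<open>F\<close> is nonzero and does define a hyperplane.\<close>
  obtain V0 P0 where V0: "psub (Suc h) V0" "chi V0 = Some P0" using ne by (auto simp: pdom_def)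
  obtain X0 where X0: "psub h X0" "X0 \<notin> K" using nontotal[OF V0] by blast
  obtain xs0 where xs0: "length xs0 = Suc h" "distinct xs0" "vec.independent (set xs0)" "vec.span (set xs0) = X0"
    using psub_basis_list[OF X0(1)] .
  then have "F xs0 \<noteq> 0" using F_iff[of xs0] X0 by (simp add: list_in_complex_def)
  then have lc: "linear_complex h K"
    unfolding linear_complex_iff_list using F F_iff xs0(1)
    by (intro exI[of _ F]) (auto simp: list_in_complex_def K_def pole_complex_def)
  show ?thesis
  proof (rule ex1I[of _ K])
    show "linear_complex h K \<and> (\<forall>V. psub (Suc h) V \<longrightarrow> chi V = dual_polarity h K V)"
      using lc polarity by blast
  next
    fix K' assume K': "linear_complex h K' \<and> (\<forall>V. psub (Suc h) V \<longrightarrow> chi V = dual_polarity h K' V)"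
    \<comment> \<open>Every \<open>X\<close> lies in some \<open>V\<close>, and \<open>chi V\<close>
      determines which \<open>h\<close>-subspaces of \<open>V\<close> belong to a complex with this
      dual polarity: all of them, or those through the pole.\<close>
    have "X \<in> K' \<longleftrightarrow> X \<in> K" if X: "psub h X" for X
    proof -
      obtain V where V: "psub (Suc h) V" "X \<subseteq> V" using psub_extend[OF X] dim by (metis Suc_le_lessD add_2_eq_Suc' diff_le_self le_trans Suc_leD)
      have chi: "chi V = dual_polarity h K' V" using K' V by blast
      show ?thesis
      proof (cases "chi V")
        case None
        then have "total h K' V" using chi V by (simp add: dual_polarity_def split: if_splits)
        then show ?thesis using exc[OF V(1) None X V(2)] X V by (simp add: total_def)
      next
        case (Some P)
        then have nt: "\<not> total h K' V" and P: "pole h K' V = P"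
          using chi V by (simp_all add: dual_polarity_def split: if_splits)
        obtain Q where Q: "psub 0 Q" "Q \<subseteq> V"
          "\<And>X. psub h X \<Longrightarrow> X \<subseteq> V \<Longrightarrow> X \<in> K' \<longleftrightarrow> Q \<subseteq> X"
          using linear_complex_pole_exists[OF _ V(1) nt] K' by blast
        have "Q = P" using pole_eqI[OF V(1) Q] P by simp
        then show ?thesis using Q(3)[OF X V(2)] iff[OF V(1) Some X V(2)] by simp
      qed
    qed
    moreover have "psub h X" if "X \<in> K' \<or> X \<in> K" for X
      using that K' by (auto simp: linear_complex_def K_def pole_complex_def)
    ultimately show "K' = K" by blast
  qed
qed

end
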